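(* Let $\mathcal K$ be a 2-category and $G=(G,d,e)$ a 2-comonad on $\mathcal K$. If $\mathcal K$ has lax descent objects for lax coherence data, and $G$ preserves them, then the inclusion 2-functor $\mathcal K^G\to\mathrm{Lax}\text{-}G\text{-}\mathrm{Coalg}_\ell$ has a right adjoint, whose value at a lax $G$-coalgebra $(A,a,\alpha,\alpha_0)$ is denoted $(\mathrm{alg}(A),a')$. Furthermore, the component at a lax $G$-coalgebra $(A,a,\alpha,\alpha_0)$ of the counit of the adjunction is a lax $G$-morphism $(q,\overline q)\colon(\mathrm{alg}(A),a')\to(A,a,\alpha,\alpha_0)$ for which $q\colon\mathrm{alg}(A)\to A$ has a left adjoint $p$ in $\mathcal K$, and this $p$ inherits a colax $G$-morphism structure: the mate $\tilde p\colon Gp\cdot a\Rightarrow a'\cdot p$ of $\overline q$ under the adjunctions $p\dashv q$ and $Gp\dashv Gq$ makes $(p,\tilde p)$ a colax $G$-morphism from $(A,a,\alpha,\alpha_0)$ to $(\mathrm{alg}(A),a')$.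
   Context: A 2-comonad $G=(G,d,e)$ on $\mathcal K$ is a 2-functor $G\colon\mathcal K\to\mathcal K$ with 2-natural comultiplication $d\colon G\to G^2$ and counit $e\colon G\to 1$ satisfying the comonad laws strictly. Whiskering is denoted by $\cdot$ (or juxtaposition) and vertical composition of 2-cells by $\circ$. Adjunctions between 2-functors are 2-adjunctions. **Lax $G$-coalgebra** $(A,a,\alpha,\alpha_0)$: an object $A$, a morphism $a\colon A\to GA$, and 2-cells $\alpha\colon Ga\cdot a\Rightarrow dA\cdot a$, $\alpha_0\colon 1_A\Rightarrow eA\cdot a$, such that: (1) $(GdA\cdot\alpha)\circ(G\alpha\cdot a)=(dGA\cdot\alpha)\circ(G^2a\cdot\alpha)$; (2) $(GeA\cdot\alpha)\circ(G\alpha_0\cdot a)=1_a$; (3) $(eGA\cdot\alpha)\circ(a\cdot\alpha_0)=1_a$. **Lax $G$-morphism** $(f,\overline f)\colon(A,a,\alpha,\alpha_0)\to(B,b,\beta,\beta_0)$: a morphism $f\colon A\to B$ and a 2-cell $\overline f\colon b\cdot f\Rightarrow Gf\cdot a$ such that: (1) $(dB\cdot\overline f)\circ(\beta\cdot f)=(G^2f\cdot\alpha)\circ(G\overline f\cdot a)\circ(Gb\cdot\overline f)$; (2) $(eB\cdot\overline f)\circ(\beta_0\cdot f)=f\cdot\alpha_0$. **Colax $G$-morphism** $(f,\tilde f)\colon(A,a,\alpha,\alpha_0)\to(B,b,\beta,\beta_0)$: a morphism $f\colon A\to B$ and a 2-cell $\tilde f\colon Gf\cdot a\Rightarrow b\cdot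 f$ such that: (1) $(\beta\cdot f)\circ(Gb\cdot\tilde f)\circ(G\tilde f\cdot a)=(dB\cdot\tilde f)\circ(G^2f\cdot\alpha)$; (2) $\beta_0\cdot f=(eB\cdot\tilde f)\circ(f\cdot\alpha_0)$. **$G$-transformation** $(f,\overline f)\to(g,\overline g)$ between lax $G$-morphisms: a 2-cell $\rho\colon f\Rightarrow g$ with $(G\rho\cdot a)\circ\overline f=\overline g\circ(b\cdot\rho)$. $\mathrm{Lax}\text{-}G\text{-}\mathrm{Coalg}_\ell$ is the 2-category of lax $G$-coalgebras, lax $G$-morphisms and $G$-transformations. $\mathcal K^G$ is the Eilenberg–Moore 2-category: strict $G$-coalgebras ($\alpha,\alpha_0$ identities), strict morphisms ($\overline f$ an identity) and $G$-transformations. **Mate.** With unit $\eta\colon 1\to qp$ and counit $\epsilon\colon pq\to 1$ of $p\dashv q$, the mate of $\overline q\colon a\cdot q\Rightarrow Gq\cdot a'$ is $\tilde p=(G\epsilon\cdot a'\cdot p)\circ(Gp\cdot\overline q\cdot p)\circ(Gp\cdot a\cdot\eta)\colon Gp\cdot a\Rightarrow a'\cdot p$. **Lax coherence data** in a 2-category $\mathcal L$: objects $X_1,X_2,X_3$, morphisms $k,l\colon X_1\to X_2$, $j\colon X_2\to X_1$, $m,n,r\colon X_2\to X_3$, and 2-cells $\gamma\colon 1\Rightarrow jk$, $\delta\colon jl\Rightarrow 1$, $\kappa\colon ml\Rightarrow nl$, $\lambda\colon rk\Rightarrow nk$, $\rho\colon rl\Rightarrow mk$. A **lax descent object** for such data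 is a universal object $L$ equipped with a morphism $v\colon L\to X_1$ and a 2-cell $\psi\colon kv\Rightarrow lv$ satisfying $$(\kappa v)\circ(m\psi)\circ(\rho v)\circ(r\psi)=(n\psi)\circ(\lambda v),\qquad(\delta v)\circ(j\psi)\circ(\gamma v)=1_v.$$ Universal means: for every $Z$, composition with $(v,\psi)$ gives an isomorphism, 2-natural in $Z$, between $\mathcal L(Z,L)$ and the category of pairs $(v'\colon Z\to X_1,\ \psi'\colon kv'\Rightarrow lv')$ satisfying these equations, with morphisms $(v',\psi')\to(v'',\psi'')$ the 2-cells $\theta\colon v'\Rightarrow v''$ with $(l\theta)\circ\psi'=\psi''\circ(k\theta)$. The example relevant to a lax $G$-coalgebra $(A,a,\alpha,\alpha_0)$ has $X_1=GA$, $X_2=G^2A$, $X_3=G^3A$, $k=Ga$, $l=dA$, $j=GeA$, $r=G^2a$, $n=GdA$, $m=dGA$, $\gamma=G\alpha_0$, $\lambda=G\alpha$, and $\delta,\kappa,\rho$ identities. *)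

theory Defs
  imports Main
begin

section \<open>Strict 2-categories\<close>

record ('o, 'm, 'c) two_cat =
  Obj :: "'o set"
  Mor :: "'m set"
  Cell :: "'c set"
  dom :: "'m \<Rightarrow> 'o"
  cod :: "'m \<Rightarrow> 'o"
  src :: "'c \<Rightarrow> 'm"
  tgt :: "'c \<Rightarrow> 'm"
  id_mor :: "'o \<Rightarrow> 'm"  (\<open>\<one>\<index>\<close>)
  id_cell :: "'m \<Rightarrow> 'c"  (\<open>\<iota>\<index>\<close>)
  comp :: "'m \<Rightarrow> 'm \<Rightarrow> 'm"  (infixr \<open>\<cdot>\<index>\<close> 75)
  vcomp :: "'c \<Rightarrow> 'c \<Rightarrow> 'c"  (infixr \<open>\<bullet>\<index>\<close> 65)
  hcomp :: "'c \<Rightarrow> 'c \<Rightarrow> 'c"  (infixr \<open>\<star>\<index>\<close> 75)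

text \<open>All compositions are written in applicative order.  They are total functions whose
  values are only meaningful on composable arguments in the carriers.\<close>

definition hom :: "('o, 'm, 'c) two_cat \<Rightarrow> 'o \<Rightarrow> 'o \<Rightarrow> 'm set"  (\<open>hom\<index>\<close>)
  where "hom\<^bsub>K\<^esub> A B = {f \<in> Mor K. dom K f = A \<and> cod K f = B}"

definition cells :: "('o, 'm, 'c) two_cat \<Rightarrow> 'm \<Rightarrow> 'm \<Rightarrow> 'c set"  (\<open>cells\<index>\<close>)
  where "cells\<^bsub>K\<^esub> f g = {\<alpha> \<in> Cell K. src K \<alpha> = f \<and> tgt K \<alpha> = g}"

definition whisker_left :: "('o, 'm, 'c) two_cat \<Rightarrow> 'm \<Rightarrow> 'c \<Rightarrow> 'c"  (infixr \<open>\<rhd>\<index>\<close> 75)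
  where "h \<rhd>\<^bsub>K\<^esub> \<alpha> = \<iota>\<^bsub>K\<^esub> h \<star>\<^bsub>K\<^esub> \<alpha>"

definition whisker_right :: "('o, 'm, 'c) two_cat \<Rightarrow> 'c \<Rightarrow> 'm \<Rightarrow> 'c"  (infixr \<open>\<lhd>\<index>\<close> 75)
  where "\<alpha> \<lhd>\<^bsub>K\<^esub> f = \<alpha> \<star>\<^bsub>K\<^esub> \<iota>\<^bsub>K\<^esub> f"

locale two_category =
  fixes K :: "('o, 'm, 'c) two_cat" (structure)
  assumes dom_in: "f \<in> Mor K \<Longrightarrow> dom K f \<in> Obj K"
    and cod_in: "f \<in> Mor K \<Longrightarrow> cod K f \<in> Obj K"
    and id_mor_in: "A \<in> Obj K \<Longrightarrow> \<one> A \<in> hom A A"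
    and comp_in: "\<lbrakk>f \<in> hom A B; g \<in> hom B C\<rbrakk> \<Longrightarrow> g \<cdot> f \<in> hom A C"
    and comp_id_left: "f \<in> hom A B \<Longrightarrow> \<one> B \<cdot> f = f"
    and comp_id_right: "f \<in> hom A B \<Longrightarrow> f \<cdot> \<one> A = f"
    and comp_assoc: "\<lbrakk>f \<in> hom A B; g \<in> hom B C; h \<in> hom C D\<rbrakk> \<Longrightarrow> (h \<cdot> g) \<cdot> f = h \<cdot> (g \<cdot> f)"
    and src_in: "\<alpha> \<in> Cell K \<Longrightarrow> src K \<alpha> \<in> Mor K"
    and tgt_in: "\<alpha> \<in> Cell K \<Longrightarrow> tgt K \<alpha> \<in> Mor K"
    and dom_src_tgt: "\<alpha> \<in> Cell K \<Longrightarrow> dom K (src K \<alpha>) = dom K (tgt K \<alpha>)"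
    and cod_src_tgt: "\<alpha> \<in> Cell K \<Longrightarrow> cod K (src K \<alpha>) = cod K (tgt K \<alpha>)"
    and id_cell_in: "f \<in> Mor K \<Longrightarrow> \<iota> f \<in> cells f f"
    and vcomp_in: "\<lbrakk>\<alpha> \<in> cells f g; \<beta> \<in> cells g h\<rbrakk> \<Longrightarrow> \<beta> \<bullet> \<alpha> \<in> cells f h"
    and vcomp_id_left: "\<alpha> \<in> cells f g \<Longrightarrow> \<iota> g \<bullet> \<alpha> = \<alpha>"
    and vcomp_id_right: "\<alpha> \<in> cells f g \<Longrightarrow> \<alpha> \<bullet> \<iota> f = \<alpha>"
    and vcomp_assoc: "\<lbrakk>\<alpha> \<in> cells f g; \<beta> \<in> cells g h; \<gamma> \<in> cells h k\<rbrakk>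
        \<Longrightarrow> (\<gamma> \<bullet> \<beta>) \<bullet> \<alpha> = \<gamma> \<bullet> (\<beta> \<bullet> \<alpha>)"
    and hcomp_in: "\<lbrakk>f \<in> hom A B; \<alpha> \<in> cells f f'; g \<in> hom B C; \<beta> \<in> cells g g'\<rbrakk>
        \<Longrightarrow> \<beta> \<star> \<alpha> \<in> cells (g \<cdot> f) (g' \<cdot> f')"
    and hcomp_id_left: "\<lbrakk>f \<in> hom A B; \<alpha> \<in> cells f f'\<rbrakk> \<Longrightarrow> \<iota> (\<one> B) \<star> \<alpha> = \<alpha>"
    and hcomp_id_right: "\<lbrakk>f \<in> hom A B; \<alpha> \<in> cells f f'\<rbrakk> \<Longrightarrow> \<alpha> \<star> \<iota> (\<one> A) = \<alpha>"
    and hcomp_assoc: "\<lbrakk>f \<in> hom A B; \<alpha> \<in> cells f f'; g \<in> hom B C; \<beta> \<in> cells g g';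
          h \<in> hom C D; \<gamma> \<in> cells h h'\<rbrakk> \<Longrightarrow> (\<gamma> \<star> \<beta>) \<star> \<alpha> = \<gamma> \<star> (\<beta> \<star> \<alpha>)"
    and hcomp_id_cell: "\<lbrakk>f \<in> hom A B; g \<in> hom B C\<rbrakk> \<Longrightarrow> \<iota> g \<star> \<iota> f = \<iota> (g \<cdot> f)"
    and interchange: "\<lbrakk>f \<in> hom A B; \<alpha> \<in> cells f f'; \<alpha>' \<in> cells f' f'';
          g \<in> hom B C; \<beta> \<in> cells g g'; \<beta>' \<in> cells g' g''\<rbrakk>
        \<Longrightarrow> (\<beta>' \<bullet> \<beta>) \<star> (\<alpha>' \<bullet> \<alpha>) = (\<beta>' \<star> \<alpha>') \<bullet> (\<beta> \<star> \<alpha>)"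

section \<open>2-functors, 2-natural transformations, 2-adjunctions\<close>

record ('o, 'm, 'c, 'p, 'n, 'd) two_functor_maps =
  Fo :: "'o \<Rightarrow> 'p"
  Fm :: "'m \<Rightarrow> 'n"
  Fc :: "'c \<Rightarrow> 'd"

definition Fcomp :: "('p, 'n, 'd, 'q, 'l, 'e) two_functor_maps \<Rightarrow> ('o, 'm, 'c, 'p, 'n, 'd) two_functor_maps
    \<Rightarrow> ('o, 'm, 'c, 'q, 'l, 'e) two_functor_maps"  (infixr \<open>\<circ>\<^sub>F\<close> 75)
  where "H \<circ>\<^sub>F F = \<lparr>Fo = Fo H \<circ> Fo F, Fm = Fm H \<circ> Fm F, Fc = Fc H \<circ> Fc F\<rparr>"

text \<open>The maps of an identity 2-functor; also those of the inclusion of a sub-2-category.\<close>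

definition Fid :: "('o, 'm, 'c, 'o, 'm, 'c) two_functor_maps"
  where "Fid = \<lparr>Fo = id, Fm = id, Fc = id\<rparr>"

locale two_functor = C: two_category C + D: two_category D
  for C :: "('o, 'm, 'c) two_cat" and D :: "('p, 'n, 'd) two_cat"
    and F :: "('o, 'm, 'c, 'p, 'n, 'd) two_functor_maps" +
  assumes Fo_in: "A \<in> Obj C \<Longrightarrow> Fo F A \<in> Obj D"
    and Fm_in: "f \<in> hom\<^bsub>C\<^esub> A B \<Longrightarrow> Fm F f \<in> hom\<^bsub>D\<^esub> (Fo F A) (Fo F B)"
    and Fc_in: "\<alpha> \<in> cells\<^bsub>C\<^esub> f g \<Longrightarrow> Fc F \<alpha> \<in> cells\<^bsub>D\<^esub> (Fm F f) (Fm F g)"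
    and Fm_id: "A \<in> Obj C \<Longrightarrow> Fm F (\<one>\<^bsub>C\<^esub> A) = \<one>\<^bsub>D\<^esub> (Fo F A)"
    and Fm_comp: "\<lbrakk>f \<in> hom\<^bsub>C\<^esub> A B; g \<in> hom\<^bsub>C\<^esub> B B'\<rbrakk>
        \<Longrightarrow> Fm F (g \<cdot>\<^bsub>C\<^esub> f) = Fm F g \<cdot>\<^bsub>D\<^esub> Fm F f"
    and Fc_id: "f \<in> Mor C \<Longrightarrow> Fc F (\<iota>\<^bsub>C\<^esub> f) = \<iota>\<^bsub>D\<^esub> (Fm F f)"
    and Fc_vcomp: "\<lbrakk>\<alpha> \<in> cells\<^bsub>C\<^esub> f g; \<beta> \<in> cells\<^bsub>C\<^esub> g h\<rbrakk>
        \<Longrightarrow> Fc F (\<beta> \<bullet>\<^bsub>C\<^esub> \<alpha>) = Fc F \<beta> \<bullet>\<^bsub>D\<^esub> Fc F \<alpha>"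
    and Fc_hcomp: "\<lbrakk>f \<in> hom\<^bsub>C\<^esub> A B; \<alpha> \<in> cells\<^bsub>C\<^esub> f f'; g \<in> hom\<^bsub>C\<^esub> B B'; \<beta> \<in> cells\<^bsub>C\<^esub> g g'\<rbrakk>
        \<Longrightarrow> Fc F (\<beta> \<star>\<^bsub>C\<^esub> \<alpha>) = Fc F \<beta> \<star>\<^bsub>D\<^esub> Fc F \<alpha>"

locale two_natural = F: two_functor C D F + H: two_functor C D H
  for C :: "('o, 'm, 'c) two_cat" and D :: "('p, 'n, 'd) two_cat"
    and F H :: "('o, 'm, 'c, 'p, 'n, 'd) two_functor_maps" and t :: "'o \<Rightarrow> 'n" +
  assumes component_in: "A \<in> Obj C \<Longrightarrow> t A \<in> hom\<^bsub>D\<^esub> (Fo F A) (Fo H A)"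
    and natural_mor: "f \<in> hom\<^bsub>C\<^esub> A B \<Longrightarrow> t B \<cdot>\<^bsub>D\<^esub> Fm F f = Fm H f \<cdot>\<^bsub>D\<^esub> t A"
    and natural_cell: "\<lbrakk>f \<in> hom\<^bsub>C\<^esub> A B; \<alpha> \<in> cells\<^bsub>C\<^esub> f f'\<rbrakk>
        \<Longrightarrow> t B \<rhd>\<^bsub>D\<^esub> Fc F \<alpha> = Fc H \<alpha> \<lhd>\<^bsub>D\<^esub> t A"

locale two_adjunction =
  left: two_functor C D F + right: two_functor D C R +
  unit: two_natural C C Fid "R \<circ>\<^sub>F F" u + counit: two_natural D D "F \<circ>\<^sub>F R" Fid c
  for C :: "('o, 'm, 'c) two_cat" and D :: "('p, 'n, 'd) two_cat"
    and F :: "('o, 'm, 'c, 'p, 'n, 'd) two_functor_maps"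
    and R :: "('p, 'n, 'd, 'o, 'm, 'c) two_functor_maps"
    and u :: "'o \<Rightarrow> 'm" and c :: "'p \<Rightarrow> 'n" +
  assumes triangle_left: "A \<in> Obj C \<Longrightarrow> c (Fo F A) \<cdot>\<^bsub>D\<^esub> Fm F (u A) = \<one>\<^bsub>D\<^esub> (Fo F A)"
    and triangle_right: "B \<in> Obj D \<Longrightarrow> Fm R (c B) \<cdot>\<^bsub>C\<^esub> u (Fo R B) = \<one>\<^bsub>C\<^esub> (Fo R B)"

section \<open>Adjunctions inside a 2-category\<close>

context
  fixes K :: "('o, 'm, 'c) two_cat" (structure)
begin

definition adjunction_in :: "'o \<Rightarrow> 'o \<Rightarrow> 'm \<Rightarrow> 'm \<Rightarrow> 'c \<Rightarrow> 'c \<Rightarrow> bool"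
  where "adjunction_in A B p q \<eta> \<epsilon> \<longleftrightarrow>
    p \<in> hom A B \<and> q \<in> hom B A \<and>
    \<eta> \<in> cells (\<one> A) (q \<cdot> p) \<and> \<epsilon> \<in> cells (p \<cdot> q) (\<one> B) \<and>
    (\<epsilon> \<lhd> p) \<bullet> (p \<rhd> \<eta>) = \<iota> p \<and> (q \<rhd> \<epsilon>) \<bullet> (\<eta> \<lhd> q) = \<iota> q"

end

section \<open>Lax descent objects\<close>

record ('o, 'm, 'c) coherence_data =
  X1 :: 'o  X2 :: 'o  X3 :: 'o
  cd_k :: 'm  cd_l :: 'm  cd_j :: 'm  cd_m :: 'm  cd_n :: 'm  cd_r :: 'm
  cd_gamma :: 'c  cd_delta :: 'c  cd_kappa :: 'c  cd_lambda :: 'c  cd_rho :: 'c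

context
  fixes K :: "('o, 'm, 'c) two_cat" (structure)
begin

definition lax_coherence_data :: "('o, 'm, 'c) coherence_data \<Rightarrow> bool"
  where "lax_coherence_data X \<longleftrightarrow>
    X1 X \<in> Obj K \<and> X2 X \<in> Obj K \<and> X3 X \<in> Obj K \<and>
    cd_k X \<in> hom (X1 X) (X2 X) \<and> cd_l X \<in> hom (X1 X) (X2 X) \<and>
    cd_j X \<in> hom (X2 X) (X1 X) \<and>
    cd_m X \<in> hom (X2 X) (X3 X) \<and> cd_n X \<in> hom (X2 X) (X3 X) \<and> cd_r X \<in> hom (X2 X) (X3 X) \<and>
    cd_gamma X \<in> cells (\<one> (X1 X)) (cd_j X \<cdot> cd_k X) \<and>
    cd_delta X \<in> cells (cd_j X \<cdot> cd_l X) (\<one> (X1 X)) \<and>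
    cd_kappa X \<in> cells (cd_m X \<cdot> cd_l X) (cd_n X \<cdot> cd_l X) \<and>
    cd_lambda X \<in> cells (cd_r X \<cdot> cd_k X) (cd_n X \<cdot> cd_k X) \<and>
    cd_rho X \<in> cells (cd_r X \<cdot> cd_l X) (cd_m X \<cdot> cd_k X)"

definition descent_pairs ::
    "('o, 'm, 'c) coherence_data \<Rightarrow> 'o \<Rightarrow> ('m \<times> 'c) set"
  where "descent_pairs X Z = {(v, \<psi>).
    v \<in> hom Z (X1 X) \<and> \<psi> \<in> cells (cd_k X \<cdot> v) (cd_l X \<cdot> v) \<and>
    (cd_kappa X \<lhd> v) \<bullet> (cd_m X \<rhd> \<psi>) \<bullet> (cd_rho X \<lhd> v) \<bullet> (cd_r X \<rhd> \<psi>)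
      = (cd_n X \<rhd> \<psi>) \<bullet> (cd_lambda X \<lhd> v) \<and>
    (cd_delta X \<lhd> v) \<bullet> (cd_j X \<rhd> \<psi>) \<bullet> (cd_gamma X \<lhd> v) = \<iota> v}"

definition descent_pair_morphisms ::
    "('o, 'm, 'c) coherence_data \<Rightarrow> 'm \<times> 'c \<Rightarrow> 'm \<times> 'c \<Rightarrow> 'c set"
  where "descent_pair_morphisms X P Q =
    {\<theta> \<in> cells (fst P) (fst Q). (cd_l X \<rhd> \<theta>) \<bullet> snd P = snd Q \<bullet> (cd_k X \<rhd> \<theta>)}"

text \<open>Composition with \<open>(v, \<psi>)\<close> sends \<open>w : Z \<rightarrow> L\<close> to \<open>(v \<cdot> w, \<psi> \<lhd> w)\<close> and \<open>\<theta> : w \<Rightarrow> w'\<close>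
  to \<open>v \<rhd> \<theta>\<close>.  It is functorial, and 2-natural in \<open>Z\<close>, by the associativity and interchange
  laws of the 2-category, so that being an isomorphism of categories means being bijective
  on objects and on each hom-set.\<close>

definition lax_descent_object ::
    "('o, 'm, 'c) coherence_data \<Rightarrow> 'o \<Rightarrow> 'm \<Rightarrow> 'c \<Rightarrow> bool"
  where "lax_descent_object X L v \<psi> \<longleftrightarrow>
    L \<in> Obj K \<and> (v, \<psi>) \<in> descent_pairs X L \<and>
    (\<forall>Z \<in> Obj K.
      bij_betw (\<lambda>w. (v \<cdot> w, \<psi> \<lhd> w)) (hom Z L) (descent_pairs X Z) \<and>
      (\<forall>w \<in> hom Z L. \<forall>w' \<in> hom Z L.
        bij_betw (\<lambda>\<theta>. v \<rhd> \<theta>) (cells w w')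
          (descent_pair_morphisms X (v \<cdot> w, \<psi> \<lhd> w) (v \<cdot> w', \<psi> \<lhd> w'))))"

end

definition map_coherence_data :: "('o, 'm, 'c, 'p, 'n, 'd) two_functor_maps
    \<Rightarrow> ('o, 'm, 'c) coherence_data \<Rightarrow> ('p, 'n, 'd) coherence_data"
  where "map_coherence_data F X =
    \<lparr>X1 = Fo F (X1 X), X2 = Fo F (X2 X), X3 = Fo F (X3 X),
     cd_k = Fm F (cd_k X), cd_l = Fm F (cd_l X), cd_j = Fm F (cd_j X),
     cd_m = Fm F (cd_m X), cd_n = Fm F (cd_n X), cd_r = Fm F (cd_r X),
     cd_gamma = Fc F (cd_gamma X), cd_delta = Fc F (cd_delta X), cd_kappa = Fc F (cd_kappa X),
     cd_lambda = Fc F (cd_lambda X), cd_rho = Fc F (cd_rho X)\<rparr>"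

definition has_lax_descent_objects :: "('o, 'm, 'c) two_cat \<Rightarrow> bool"
  where "has_lax_descent_objects K \<longleftrightarrow>
    (\<forall>X. lax_coherence_data K X \<longrightarrow> (\<exists>L v \<psi>. lax_descent_object K X L v \<psi>))"

definition preserves_lax_descent_objects ::
    "('o, 'm, 'c) two_cat \<Rightarrow> ('p, 'n, 'd) two_cat \<Rightarrow> ('o, 'm, 'c, 'p, 'n, 'd) two_functor_maps \<Rightarrow> bool"
  where "preserves_lax_descent_objects C D F \<longleftrightarrow>
    (\<forall>X L v \<psi>. lax_coherence_data C X \<longrightarrow> lax_descent_object C X L v \<psi> \<longrightarrow>
      lax_descent_object D (map_coherence_data F X) (Fo F L) (Fm F v) (Fc F \<psi>))"

section \<open>2-comonads and their lax coalgebras\<close>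

locale two_comonad =
  comult: two_natural K K G "G \<circ>\<^sub>F G" d + counit: two_natural K K G Fid e
  for K :: "('o, 'm, 'c) two_cat" (structure)
    and G :: "('o, 'm, 'c, 'o, 'm, 'c) two_functor_maps"
    and d e :: "'o \<Rightarrow> 'm" +
  assumes coassoc: "A \<in> Obj K \<Longrightarrow> Fm G (d A) \<cdot> d A = d (Fo G A) \<cdot> d A"
    and counit_left: "A \<in> Obj K \<Longrightarrow> e (Fo G A) \<cdot> d A = \<one> (Fo G A)"
    and counit_right: "A \<in> Obj K \<Longrightarrow> Fm G (e A) \<cdot> d A = \<one> (Fo G A)"

datatype ('o, 'm, 'c) coalg =
  Coalg (carrier: 'o) (structure_mor: 'm) (structure_comult: 'c) (structure_counit: 'c)

text \<open>The morphisms and 2-cells of the 2-categories of coalgebras carry their source and target.\<close>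

datatype ('o, 'm, 'c) coalg_mor =
  CoalgMor (mor_dom: "('o, 'm, 'c) coalg") (mor_cod: "('o, 'm, 'c) coalg")
    (mor_under: 'm) (mor_cell: 'c)

datatype ('o, 'm, 'c) coalg_cell =
  CoalgCell (cell_src: "('o, 'm, 'c) coalg_mor") (cell_tgt: "('o, 'm, 'c) coalg_mor")
    (cell_under: 'c)

context
  fixes K :: "('o, 'm, 'c) two_cat" (structure)
    and G :: "('o, 'm, 'c, 'o, 'm, 'c) two_functor_maps"
    and d e :: "'o \<Rightarrow> 'm"
begin

fun is_lax_coalgebra :: "('o, 'm, 'c) coalg \<Rightarrow> bool"
  where "is_lax_coalgebra (Coalg A a \<alpha> \<alpha>\<^sub>0) \<longleftrightarrow>
    A \<in> Obj K \<and> a \<in> hom A (Fo G A) \<and>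
    \<alpha> \<in> cells (Fm G a \<cdot> a) (d A \<cdot> a) \<and>
    \<alpha>\<^sub>0 \<in> cells (\<one> A) (e A \<cdot> a) \<and>
    (Fm G (d A) \<rhd> \<alpha>) \<bullet> (Fc G \<alpha> \<lhd> a)
      = (d (Fo G A) \<rhd> \<alpha>) \<bullet> (Fm G (Fm G a) \<rhd> \<alpha>) \<and>
    (Fm G (e A) \<rhd> \<alpha>) \<bullet> (Fc G \<alpha>\<^sub>0 \<lhd> a) = \<iota> a \<and>
    (e (Fo G A) \<rhd> \<alpha>) \<bullet> (a \<rhd> \<alpha>\<^sub>0) = \<iota> a"

fun is_lax_morphism :: "('o, 'm, 'c) coalg \<Rightarrow> ('o, 'm, 'c) coalg \<Rightarrow> 'm \<Rightarrow> 'c \<Rightarrow> bool"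
  where "is_lax_morphism (Coalg A a \<alpha> \<alpha>\<^sub>0) (Coalg B b \<beta> \<beta>\<^sub>0) f f\<^sub>2 \<longleftrightarrow>
    f \<in> hom A B \<and> f\<^sub>2 \<in> cells (b \<cdot> f) (Fm G f \<cdot> a) \<and>
    (d B \<rhd> f\<^sub>2) \<bullet> (\<beta> \<lhd> f)
      = (Fm G (Fm G f) \<rhd> \<alpha>) \<bullet> (Fc G f\<^sub>2 \<lhd> a) \<bullet> (Fm G b \<rhd> f\<^sub>2) \<and>
    (e B \<rhd> f\<^sub>2) \<bullet> (\<beta>\<^sub>0 \<lhd> f) = f \<rhd> \<alpha>\<^sub>0"

fun is_colax_morphism :: "('o, 'm, 'c) coalg \<Rightarrow> ('o, 'm, 'c) coalg \<Rightarrow> 'm \<Rightarrow> 'c \<Rightarrow> bool"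
  where "is_colax_morphism (Coalg A a \<alpha> \<alpha>\<^sub>0) (Coalg B b \<beta> \<beta>\<^sub>0) f f\<^sub>2 \<longleftrightarrow>
    f \<in> hom A B \<and> f\<^sub>2 \<in> cells (Fm G f \<cdot> a) (b \<cdot> f) \<and>
    (\<beta> \<lhd> f) \<bullet> (Fm G b \<rhd> f\<^sub>2) \<bullet> (Fc G f\<^sub>2 \<lhd> a)
      = (d B \<rhd> f\<^sub>2) \<bullet> (Fm G (Fm G f) \<rhd> \<alpha>) \<and>
    \<beta>\<^sub>0 \<lhd> f = (e B \<rhd> f\<^sub>2) \<bullet> (f \<rhd> \<alpha>\<^sub>0)"

text \<open>The mate of \<open>q\<^sub>2 : a \<cdot> q \<Rightarrow> Gq \<cdot> a'\<close> under \<open>p \<stileturn> q\<close> (unit \<open>\<eta>\<close>, counit \<open>\<epsilon>\<close>)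
  and \<open>Gp \<stileturn> Gq\<close>.\<close>

definition mate :: "'m \<Rightarrow> 'm \<Rightarrow> 'm \<Rightarrow> 'c \<Rightarrow> 'c \<Rightarrow> 'c \<Rightarrow> 'c"
  where "mate a a' p \<eta> \<epsilon> q\<^sub>2 =
    (Fc G \<epsilon> \<lhd> (a' \<cdot> p)) \<bullet> (Fm G p \<rhd> (q\<^sub>2 \<lhd> p)) \<bullet> ((Fm G p \<cdot> a) \<rhd> \<eta>)"

fun is_G_transformation :: "('o, 'm, 'c) coalg_mor \<Rightarrow> ('o, 'm, 'c) coalg_mor \<Rightarrow> 'c \<Rightarrow> bool"
  where "is_G_transformation (CoalgMor X Y f f\<^sub>2) (CoalgMor X' Y' g g\<^sub>2) \<rho> \<longleftrightarrow>
    X = X' \<and> Y = Y' \<and> \<rho> \<in> cells f g \<and>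
    (Fc G \<rho> \<lhd> structure_mor X) \<bullet> f\<^sub>2 = g\<^sub>2 \<bullet> (structure_mor Y \<rhd> \<rho>)"

fun coalg_mor_comp :: "('o, 'm, 'c) coalg_mor \<Rightarrow> ('o, 'm, 'c) coalg_mor \<Rightarrow> ('o, 'm, 'c) coalg_mor"
  where "coalg_mor_comp (CoalgMor Y Z g g\<^sub>2) (CoalgMor X Y' f f\<^sub>2) =
    CoalgMor X Z (g \<cdot> f) ((Fm G g \<rhd> f\<^sub>2) \<bullet> (g\<^sub>2 \<lhd> f))"

definition Lax_Coalg :: "(('o, 'm, 'c) coalg, ('o, 'm, 'c) coalg_mor, ('o, 'm, 'c) coalg_cell) two_cat"
  where "Lax_Coalg =
    (let O\<^sub>0 = {X. is_lax_coalgebra X};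
         M\<^sub>0 = {F. mor_dom F \<in> O\<^sub>0 \<and> mor_cod F \<in> O\<^sub>0 \<and>
                 is_lax_morphism (mor_dom F) (mor_cod F) (mor_under F) (mor_cell F)}
     in \<lparr>Obj = O\<^sub>0, Mor = M\<^sub>0,
         Cell = {\<sigma>. cell_src \<sigma> \<in> M\<^sub>0 \<and> cell_tgt \<sigma> \<in> M\<^sub>0 \<and>
                   is_G_transformation (cell_src \<sigma>) (cell_tgt \<sigma>) (cell_under \<sigma>)},
         dom = mor_dom, cod = mor_cod, src = cell_src, tgt = cell_tgt,
         id_mor = (\<lambda>X. CoalgMor X X (\<one> (carrier X)) (\<iota> (structure_mor X))),
         id_cell = (\<lambda>F. CoalgCell F F (\<iota> (mor_under F))),
         comp = coalg_mor_comp,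
         vcomp = (\<lambda>\<tau> \<sigma>. CoalgCell (cell_src \<sigma>) (cell_tgt \<tau>) (cell_under \<tau> \<bullet> cell_under \<sigma>)),
         hcomp = (\<lambda>\<tau> \<sigma>. CoalgCell (coalg_mor_comp (cell_src \<tau>) (cell_src \<sigma>))
                               (coalg_mor_comp (cell_tgt \<tau>) (cell_tgt \<sigma>))
                               (cell_under \<tau> \<star> cell_under \<sigma>))\<rparr>)"

fun is_strict_coalgebra :: "('o, 'm, 'c) coalg \<Rightarrow> bool"
  where "is_strict_coalgebra (Coalg A a \<alpha> \<alpha>\<^sub>0) \<longleftrightarrow>
    is_lax_coalgebra (Coalg A a \<alpha> \<alpha>\<^sub>0) \<and>
    \<alpha> = \<iota> (Fm G a \<cdot> a) \<and> \<alpha>\<^sub>0 = \<iota> (\<one> A)"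

text \<open>The Eilenberg--Moore 2-category, as a sub-2-category of \<open>Lax_Coalg\<close>.\<close>

definition EM :: "(('o, 'm, 'c) coalg, ('o, 'm, 'c) coalg_mor, ('o, 'm, 'c) coalg_cell) two_cat"
  where "EM =
    (let L = Lax_Coalg;
         O\<^sub>0 = {X \<in> Obj L. is_strict_coalgebra X};
         M\<^sub>0 = {F \<in> Mor L. mor_dom F \<in> O\<^sub>0 \<and> mor_cod F \<in> O\<^sub>0 \<and>
                 mor_cell F = \<iota> (structure_mor (mor_cod F) \<cdot> mor_under F)}
     in L\<lparr>Obj := O\<^sub>0, Mor := M\<^sub>0, Cell := {\<sigma> \<in> Cell L. cell_src \<sigma> \<in> M\<^sub>0 \<and> cell_tgt \<sigma> \<in> M\<^sub>0}\<rparr>)"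

end

end

theory Submission
  imports Defs
begin

text \<open>Let \<open>(A, a, \<alpha>, \<alpha>\<^sub>0)\<close> be a lax coalgebra and \<open>(L, v, \<psi>)\<close> the lax descent object of the
coherence data on \<open>GA\<close>, \<open>G\<^sup>2A\<close>, \<open>G\<^sup>3A\<close> that it determines.  The object \<open>L\<close> classifies lax
morphisms out of strict coalgebras: given a strict coalgebra \<open>(B, b)\<close> and a lax morphism
\<open>(f, f\<^sub>2)\<close> from it to \<open>A\<close>, the pair \<open>(Gf \<cdot> b, Gf\<^sub>2 \<cdot> b)\<close> satisfies the descent equations,
because these are the images under \<open>G\<close> of the two axioms on \<open>f\<^sub>2\<close>, whiskered with \<open>b\<close>.
So it factors through \<open>(v, \<psi>)\<close> by a unique \<open>g : B \<rightarrow> L\<close> (\<open>ex_transpose\<close>).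

For \<open>g\<close> to be a morphism of coalgebras, \<open>L\<close> needs a coalgebra structure.  Here the
preservation hypothesis enters: \<open>GL\<close> is the descent object of the image of the data under
\<open>G\<close>, the pair \<open>(dA \<cdot> v, dGA \<cdot> \<psi>)\<close> satisfies its equations, and the induced map
\<open>a' : L \<rightarrow> GL\<close> is the structure (\<open>ex_strict_structure\<close>).  Coassociativity and counitality of
\<open>a'\<close> hold strictly, by the uniqueness of factorizations through \<open>G\<^sup>2L\<close> and \<open>L\<close>.  The lax
morphism \<open>q = eA \<cdot> v\<close> with \<open>q\<^sub>2 = eGA \<cdot> \<psi>\<close> undoes the passage from \<open>f\<close> to \<open>Gf \<cdot> b\<close>, since
\<open>eA \<cdot> Gf \<cdot> b = f \<cdot> eB \<cdot> b = f\<close>; conversely \<open>v\<close> and \<open>\<psi>\<close> whiskered with a strict morphism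
are recovered from \<open>q\<close> and \<open>q\<^sub>2\<close> (\<open>recover_from_q\<close>).  Hence \<open>(q, q\<^sub>2)\<close> is a universal
arrow, on morphisms (\<open>counit_universal_mor\<close>) and on 2-cells (\<open>counit_universal_cell\<close>), and
such a family of universal arrows is the counit of a 2-adjunction
(\<open>two_adjunction_of_universal_arrows\<close>).

The pair \<open>(a, \<alpha>)\<close> is itself a descent pair, by the coassociativity axiom and the first counit
axiom of \<open>A\<close>; it yields \<open>p : A \<rightarrow> L\<close> with \<open>v \<cdot> p = a\<close> and \<open>\<psi> \<cdot> p = \<alpha>\<close>.  Then
\<open>q \<cdot> p = eA \<cdot> a\<close>, so \<open>\<alpha>\<^sub>0\<close> is a candidate unit, and the counit \<open>\<epsilon>\<close> is the 2-cell with
\<open>v \<cdot> \<epsilon> = q\<^sub>2\<close> (\<open>adjunction_p_q\<close>).  The mate of \<open>q\<^sub>2\<close> becomes \<open>\<alpha>\<close> when whiskered with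
\<open>Gv\<close> (\<open>v_mate\<close>).  Whiskering with \<open>v\<close> and with \<open>G\<^sup>2v\<close> is faithful on 2-cells, and it turns
the colax axioms for the mate into axioms of the lax coalgebra (\<open>mate_colax_morphism\<close>).\<close>

section \<open>A calculus of pasting diagrams\<close>

text \<open>Pasting diagrams are computed by rewriting.  A 1-cell \<open>f\<close> enters a calculation only as
the 2-cell \<open>\<iota> f\<close>, so that composition of 1-cells and both whiskerings become instances of
the one associative product \<open>\<star>\<close>, and a naturality square is a single equation that serves
1-cells and 2-cells alike.  Vertical composites are normalized by distributing identity
2-cells over them.  The axioms are restated with explicit domains and codomains instead of
hom-sets, so that every typing condition can be discharged by evaluating both of its sides.\<close>

context two_category
begin

lemma hom_iff: "f \<in> hom A B \<longleftrightarrow> f \<in> Mor K \<and> dom K f = A \<and> cod K f = B"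
  by (simp add: hom_def)

lemma cells_iff: "\<alpha> \<in> cells f g \<longleftrightarrow> \<alpha> \<in> Cell K \<and> src K \<alpha> = f \<and> tgt K \<alpha> = g"
  by (simp add: cells_def)

lemma mor_simps [simp]:
  "f \<in> Mor K \<Longrightarrow> dom K f \<in> Obj K" "f \<in> Mor K \<Longrightarrow> cod K f \<in> Obj K"
  by (rule dom_in cod_in, assumption)+

lemma id_mor_simps [simp]:
  assumes "A \<in> Obj K"
  shows "\<one> A \<in> Mor K" "dom K (\<one> A) = A" "cod K (\<one> A) = A"
  using id_mor_in[OF assms] by (auto simp: hom_def)

lemma comp_simps [simp]:
  assumes "f \<in> Mor K" "g \<in> Mor K" "dom K g = cod K f"
  shows "g \<cdot> f \<in> Mor K" "dom K (g \<cdot> f) = dom K f" "cod K (g \<cdot> f) = cod K g"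
  using comp_in[of f "dom K f" "cod K f" g "cod K g"] assms by (auto simp: hom_def)

lemma cell_simps [simp]:
  assumes "\<alpha> \<in> Cell K"
  shows "src K \<alpha> \<in> Mor K" "tgt K \<alpha> \<in> Mor K"
    "dom K (tgt K \<alpha>) = dom K (src K \<alpha>)" "cod K (tgt K \<alpha>) = cod K (src K \<alpha>)"
  using assms src_in tgt_in dom_src_tgt cod_src_tgt by auto

lemma id_cell_simps [simp]:
  assumes "f \<in> Mor K"
  shows "\<iota> f \<in> Cell K" "src K (\<iota> f) = f" "tgt K (\<iota> f) = f"
  using id_cell_in[OF assms] by (auto simp: cells_def)

lemma hcomp_simps [simp]:
  assumes "\<alpha> \<in> Cell K" "\<beta> \<in> Cell K" "dom K (src K \<beta>) = cod K (src K \<alpha>)"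
  shows "\<beta> \<star> \<alpha> \<in> Cell K" "src K (\<beta> \<star> \<alpha>) = src K \<beta> \<cdot> src K \<alpha>"
    "tgt K (\<beta> \<star> \<alpha>) = tgt K \<beta> \<cdot> tgt K \<alpha>"
  using hcomp_in[of "src K \<alpha>" "dom K (src K \<alpha>)" "cod K (src K \<alpha>)" \<alpha> "tgt K \<alpha>" "src K \<beta>"
      "cod K (src K \<beta>)" \<beta> "tgt K \<beta>"] assms
  by (auto simp: hom_iff cells_iff)

lemma id_cell_inject: "f \<in> Mor K \<Longrightarrow> g \<in> Mor K \<Longrightarrow> \<iota> f = \<iota> g \<longleftrightarrow> f = g"
  by (metis id_cell_simps(2))

lemma mor_eqI: "\<iota> f = \<iota> g \<Longrightarrow> f \<in> Mor K \<Longrightarrow> g \<in> Mor K \<Longrightarrow> f = g"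
  by (simp add: id_cell_inject)

text \<open>The condition for a vertical composite compares \<open>\<iota> (src \<beta>)\<close> with \<open>\<iota> (tgt \<alpha>)\<close> rather than
the 1-cells themselves: as 2-cells they can be rewritten with the same equations as the rest of
a diagram.\<close>

lemma vcomp_simps [simp]:
  assumes "\<alpha> \<in> Cell K" "\<beta> \<in> Cell K" "\<iota> (src K \<beta>) = \<iota> (tgt K \<alpha>)"
  shows "\<beta> \<bullet> \<alpha> \<in> Cell K" "src K (\<beta> \<bullet> \<alpha>) = src K \<alpha>" "tgt K (\<beta> \<bullet> \<alpha>) = tgt K \<beta>"
  using vcomp_in[of \<alpha> "src K \<alpha>" "tgt K \<alpha>" \<beta> "tgt K \<beta>"] assms
  by (auto simp: cells_iff id_cell_inject)

lemma comp_id_left' [simp]: "f \<in> Mor K \<Longrightarrow> cod K f = B \<Longrightarrow> \<one> B \<cdot> f = f"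
  and comp_id_right' [simp]: "f \<in> Mor K \<Longrightarrow> dom K f = A \<Longrightarrow> f \<cdot> \<one> A = f"
  using comp_id_left comp_id_right by (auto simp: hom_iff)

lemma comp_assoc' [simp]:
  "\<lbrakk>f \<in> Mor K; g \<in> Mor K; h \<in> Mor K; dom K h = cod K g; dom K g = cod K f\<rbrakk>
    \<Longrightarrow> (h \<cdot> g) \<cdot> f = h \<cdot> (g \<cdot> f)"
  using comp_assoc by (auto simp: hom_iff)

lemma hcomp_id_left' [simp]: "\<alpha> \<in> Cell K \<Longrightarrow> cod K (src K \<alpha>) = B \<Longrightarrow> \<iota> (\<one> B) \<star> \<alpha> = \<alpha>"
  and hcomp_id_right' [simp]: "\<alpha> \<in> Cell K \<Longrightarrow> dom K (src K \<alpha>) = A \<Longrightarrow> \<alpha> \<star> \<iota> (\<one> A) = \<alpha>"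
  using hcomp_id_left[of "src K \<alpha>" "dom K (src K \<alpha>)" B \<alpha>]
    hcomp_id_right[of "src K \<alpha>" A "cod K (src K \<alpha>)" \<alpha>] by (auto simp: hom_iff cells_iff)

lemma hcomp_assoc' [simp]:
  "\<lbrakk>\<alpha> \<in> Cell K; \<beta> \<in> Cell K; \<gamma> \<in> Cell K; dom K (src K \<gamma>) = cod K (src K \<beta>);
    dom K (src K \<beta>) = cod K (src K \<alpha>)\<rbrakk> \<Longrightarrow> (\<gamma> \<star> \<beta>) \<star> \<alpha> = \<gamma> \<star> (\<beta> \<star> \<alpha>)"
  using hcomp_assoc[of "src K \<alpha>" "dom K (src K \<alpha>)" "cod K (src K \<alpha>)" \<alpha> "tgt K \<alpha>" "src K \<beta>"
      "cod K (src K \<beta>)" \<beta> "tgt K \<beta>" "src K \<gamma>" "cod K (src K \<gamma>)" \<gamma> "tgt K \<gamma>"]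
  by (auto simp: hom_iff cells_iff)

lemma vcomp_id_left' [simp]: "\<alpha> \<in> Cell K \<Longrightarrow> g \<in> Mor K \<Longrightarrow> \<iota> g = \<iota> (tgt K \<alpha>) \<Longrightarrow> \<iota> g \<bullet> \<alpha> = \<alpha>"
  and vcomp_id_right' [simp]: "\<alpha> \<in> Cell K \<Longrightarrow> f \<in> Mor K \<Longrightarrow> \<iota> f = \<iota> (src K \<alpha>) \<Longrightarrow> \<alpha> \<bullet> \<iota> f = \<alpha>"
  using vcomp_id_left[of \<alpha> "src K \<alpha>" g] vcomp_id_right[of \<alpha> f "tgt K \<alpha>"]
  by (auto simp: cells_iff id_cell_inject)

lemma vcomp_assoc' [simp]:
  "\<lbrakk>\<alpha> \<in> Cell K; \<beta> \<in> Cell K; \<gamma> \<in> Cell K; \<iota> (src K \<gamma>) = \<iota> (tgt K \<beta>);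
    \<iota> (src K \<beta>) = \<iota> (tgt K \<alpha>)\<rbrakk> \<Longrightarrow> (\<gamma> \<bullet> \<beta>) \<bullet> \<alpha> = \<gamma> \<bullet> (\<beta> \<bullet> \<alpha>)"
  using vcomp_assoc by (auto simp: cells_iff id_cell_inject)

lemma id_cell_comp: "\<lbrakk>f \<in> Mor K; g \<in> Mor K; dom K g = cod K f\<rbrakk> \<Longrightarrow> \<iota> (g \<cdot> f) = \<iota> g \<star> \<iota> f"
  using hcomp_id_cell by (auto simp: hom_iff)

lemma interchange':
  "\<lbrakk>\<alpha> \<in> Cell K; \<alpha>' \<in> Cell K; \<beta> \<in> Cell K; \<beta>' \<in> Cell K; \<iota> (src K \<alpha>') = \<iota> (tgt K \<alpha>);
    \<iota> (src K \<beta>') = \<iota> (tgt K \<beta>); dom K (src K \<beta>) = cod K (src K \<alpha>)\<rbrakk>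
    \<Longrightarrow> (\<beta>' \<bullet> \<beta>) \<star> (\<alpha>' \<bullet> \<alpha>) = (\<beta>' \<star> \<alpha>') \<bullet> (\<beta> \<star> \<alpha>)"
  using interchange[of "src K \<alpha>" "dom K (src K \<alpha>)" "cod K (src K \<alpha>)" \<alpha> "tgt K \<alpha>" \<alpha>' "tgt K \<alpha>'"
      "src K \<beta>" "cod K (src K \<beta>)" \<beta> "tgt K \<beta>" \<beta>' "tgt K \<beta>'"]
  by (auto simp: hom_iff cells_iff id_cell_inject)

text \<open>A composite such as \<open>\<iota> g \<star> \<iota> f\<close> is an identity 2-cell without having the form \<open>\<iota> h\<close>.  This
predicate recognizes the factors that distribute over vertical composition.\<close>

definition identity_cell :: "'c \<Rightarrow> bool"
  where "identity_cell x \<longleftrightarrow> (\<exists>f \<in> Mor K. x = \<iota> f)"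

lemma identity_cell_id [simp]: "f \<in> Mor K \<Longrightarrow> identity_cell (\<iota> f)"
  by (auto simp: identity_cell_def)

lemma identity_cell_hcomp [simp]:
  assumes "identity_cell x" "identity_cell y" "dom K (src K y) = cod K (src K x)"
  shows "identity_cell (y \<star> x)"
  using assms by (auto simp: identity_cell_def id_cell_comp[symmetric] intro: bexI[of _ "_ \<cdot> _"])

lemma identity_cell_vcomp: "identity_cell x \<Longrightarrow> x \<bullet> x = x"
  and identity_cell_in: "identity_cell x \<Longrightarrow> x \<in> Cell K"
  and identity_cell_src: "identity_cell x \<Longrightarrow> \<iota> (src K x) = x"
  and identity_cell_tgt: "identity_cell x \<Longrightarrow> \<iota> (tgt K x) = x"
  by (auto simp: identity_cell_def)

lemma whisker_vcomp [simp]: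
  assumes "identity_cell x" "\<alpha> \<in> Cell K" "\<beta> \<in> Cell K" "\<iota> (src K \<beta>) = \<iota> (tgt K \<alpha>)"
  shows "dom K (src K x) = cod K (src K \<alpha>) \<Longrightarrow> x \<star> (\<beta> \<bullet> \<alpha>) = (x \<star> \<beta>) \<bullet> (x \<star> \<alpha>)"
    and "dom K (src K \<alpha>) = cod K (src K x) \<Longrightarrow> (\<beta> \<bullet> \<alpha>) \<star> x = (\<beta> \<star> x) \<bullet> (\<alpha> \<star> x)"
proof -
  have eq: "src K \<beta> = tgt K \<alpha>" using assms by (simp add: id_cell_inject)
  note i = identity_cell_vcomp[OF assms(1)] identity_cell_in[OF assms(1)]
    identity_cell_src[OF assms(1)] identity_cell_tgt[OF assms(1)]
  show "dom K (src K x) = cod K (src K \<alpha>) \<Longrightarrow> x \<star> (\<beta> \<bullet> \<alpha>) = (x \<star> \<beta>) \<bullet> (x \<star> \<alpha>)"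
    using interchange'[of \<alpha> \<beta> x x] assms eq i by simp
  show "dom K (src K \<alpha>) = cod K (src K x) \<Longrightarrow> (\<beta> \<bullet> \<alpha>) \<star> x = (\<beta> \<star> x) \<bullet> (\<alpha> \<star> x)"
    using interchange'[of x x \<alpha> \<beta>] assms eq i by simp
qed

text \<open>Each side is one order of performing two 2-cells that sit side by side; comparing the two
sides lets 2-cells in different columns of a diagram pass each other.\<close>

lemma hcomp_decompose:
  assumes "\<alpha> \<in> Cell K" "\<beta> \<in> Cell K" "dom K (src K \<beta>) = cod K (src K \<alpha>)"
  shows "\<beta> \<star> \<alpha> = (\<beta> \<star> \<iota> (tgt K \<alpha>)) \<bullet> (\<iota> (src K \<beta>) \<star> \<alpha>)"
    and "\<beta> \<star> \<alpha> = (\<iota> (tgt K \<beta>) \<star> \<alpha>) \<bullet> (\<beta> \<star> \<iota> (src K \<alpha>))"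
  using interchange'[of \<alpha> "\<iota> (tgt K \<alpha>)" "\<iota> (src K \<beta>)" \<beta>]
    interchange'[of "\<iota> (src K \<alpha>)" \<alpha> \<beta> "\<iota> (tgt K \<beta>)"] assms by simp_all

lemma vcomp_identity [simp]:
  assumes "identity_cell x" "\<alpha> \<in> Cell K"
  shows "x = \<iota> (tgt K \<alpha>) \<Longrightarrow> x \<bullet> \<alpha> = \<alpha>" "x = \<iota> (src K \<alpha>) \<Longrightarrow> \<alpha> \<bullet> x = \<alpha>"
  using assms by auto

text \<open>Composites are associated to the right, so an equation for a product of two factors has to
be stated once more with a further factor behind it.\<close>

lemma vcomp_tail:
  assumes "\<beta> \<bullet> \<alpha> = \<gamma>" "\<alpha> \<in> Cell K" "\<beta> \<in> Cell K" "\<iota> (src K \<beta>) = \<iota> (tgt K \<alpha>)"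
    "\<delta> \<in> Cell K" "\<iota> (src K \<alpha>) = \<iota> (tgt K \<delta>)"
  shows "\<beta> \<bullet> (\<alpha> \<bullet> \<delta>) = \<gamma> \<bullet> \<delta>"
  using assms vcomp_assoc' by metis

lemma hcomp_tail:
  assumes "x \<star> y = z" "x \<in> Cell K" "y \<in> Cell K" "dom K (src K x) = cod K (src K y)"
    "w \<in> Cell K" "dom K (src K y) = cod K (src K w)"
  shows "x \<star> (y \<star> w) = z \<star> w"
  using assms hcomp_assoc' by metis

lemma hcomp_exchange_tail:
  assumes "x \<star> y = x' \<star> y'" "x \<in> Cell K" "y \<in> Cell K" "dom K (src K x) = cod K (src K y)"
    "x' \<in> Cell K" "y' \<in> Cell K" "dom K (src K x') = cod K (src K y')"
    "w \<in> Cell K" "dom K (src K y) = cod K (src K w)" "dom K (src K y') = cod K (src K w)"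
  shows "x \<star> (y \<star> w) = x' \<star> (y' \<star> w)"
  using assms hcomp_assoc' by metis

lemmas whisker_defs = whisker_left_def whisker_right_def

end

context two_functor
begin

lemma F_simps [simp]:
  shows "A \<in> Obj C \<Longrightarrow> Fo F A \<in> Obj D"
    and "f \<in> Mor C \<Longrightarrow> Fm F f \<in> Mor D"
    and "f \<in> Mor C \<Longrightarrow> dom D (Fm F f) = Fo F (dom C f)"
    and "f \<in> Mor C \<Longrightarrow> cod D (Fm F f) = Fo F (cod C f)"
    and "\<alpha> \<in> Cell C \<Longrightarrow> Fc F \<alpha> \<in> Cell D"
    and "\<alpha> \<in> Cell C \<Longrightarrow> src D (Fc F \<alpha>) = Fm F (src C \<alpha>)"
    and "\<alpha> \<in> Cell C \<Longrightarrow> tgt D (Fc F \<alpha>) = Fm F (tgt C \<alpha>)"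
  using Fo_in Fm_in[of f "dom C f" "cod C f"] Fc_in[of \<alpha> "src C \<alpha>" "tgt C \<alpha>"]
  by (auto simp: C.hom_iff D.hom_iff C.cells_iff D.cells_iff)

lemma Fm_id' [simp]: "A \<in> Obj C \<Longrightarrow> Fm F (\<one>\<^bsub>C\<^esub> A) = \<one>\<^bsub>D\<^esub> (Fo F A)"
  by (rule Fm_id)

lemma Fm_comp' [simp]: "\<lbrakk>f \<in> Mor C; g \<in> Mor C; dom C g = cod C f\<rbrakk>
    \<Longrightarrow> Fm F (g \<cdot>\<^bsub>C\<^esub> f) = Fm F g \<cdot>\<^bsub>D\<^esub> Fm F f"
  using Fm_comp[of f "dom C f" "cod C f" g "cod C g"] by (auto simp: C.hom_iff)

lemma id_cell_Fm: "f \<in> Mor C \<Longrightarrow> \<iota>\<^bsub>D\<^esub> (Fm F f) = Fc F (\<iota>\<^bsub>C\<^esub> f)"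
  using Fc_id by simp

lemma Fc_hcomp' [simp]: "\<lbrakk>\<alpha> \<in> Cell C; \<beta> \<in> Cell C; dom C (src C \<beta>) = cod C (src C \<alpha>)\<rbrakk>
    \<Longrightarrow> Fc F (\<beta> \<star>\<^bsub>C\<^esub> \<alpha>) = Fc F \<beta> \<star>\<^bsub>D\<^esub> Fc F \<alpha>"
  using Fc_hcomp[of "src C \<alpha>" "dom C (src C \<alpha>)" "cod C (src C \<alpha>)" \<alpha> "tgt C \<alpha>"
     "src C \<beta>" "cod C (src C \<beta>)" \<beta> "tgt C \<beta>"] by (auto simp: C.hom_iff C.cells_iff)

lemma Fc_vcomp' [simp]: "\<lbrakk>\<alpha> \<in> Cell C; \<beta> \<in> Cell C; \<iota>\<^bsub>C\<^esub> (src C \<beta>) = \<iota>\<^bsub>C\<^esub> (tgt C \<alpha>)\<rbrakk>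
    \<Longrightarrow> Fc F (\<beta> \<bullet>\<^bsub>C\<^esub> \<alpha>) = Fc F \<beta> \<bullet>\<^bsub>D\<^esub> Fc F \<alpha>"
  using Fc_vcomp by (auto simp: C.cells_iff C.id_cell_inject)

lemma identity_cell_Fc [simp]: "C.identity_cell x \<Longrightarrow> D.identity_cell (Fc F x)"
  unfolding C.identity_cell_def D.identity_cell_def by (auto simp: id_cell_Fm[symmetric])

lemma Fc_id_mor [simp]: "A \<in> Obj C \<Longrightarrow> Fc F (\<iota>\<^bsub>C\<^esub> (\<one>\<^bsub>C\<^esub> A)) = \<iota>\<^bsub>D\<^esub> (\<one>\<^bsub>D\<^esub> (Fo F A))"
  by (simp add: id_cell_Fm[symmetric])

end

lemma (in two_category) two_functor_Fid: "two_functor K K Fid"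
  by unfold_locales (auto simp: Fid_def)

lemma two_functor_Fcomp:
  assumes "two_functor C D F" "two_functor D E H"
  shows "two_functor C E (H \<circ>\<^sub>F F)"
proof -
  interpret F: two_functor C D F by fact
  interpret H: two_functor D E H by fact
  show ?thesis
    by unfold_locales (auto simp: Fcomp_def F.C.hom_iff F.D.hom_iff H.D.hom_iff
        F.C.cells_iff F.D.cells_iff H.D.cells_iff H.id_cell_Fm F.id_cell_Fm F.C.id_cell_inject
        F.D.id_cell_inject)
qed

section \<open>Maps into lax descent objects\<close>

context two_category
begin

lemma descent_object_simps:
  assumes "lax_descent_object K X L v \<psi>"
  shows "L \<in> Obj K" "v \<in> Mor K" "dom K v = L" "cod K v = X1 X" "\<psi> \<in> Cell K"
    "src K \<psi> = cd_k X \<cdot> v" "tgt K \<psi> = cd_l X \<cdot> v" "(v, \<psi>) \<in> descent_pairs K X L"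
  using assms by (auto simp: lax_descent_object_def descent_pairs_def hom_def cells_def)

lemma descent_factor:
  assumes "lax_descent_object K X L v \<psi>" "(w, \<phi>) \<in> descent_pairs K X Z" "Z \<in> Obj K"
  shows "\<exists>g. g \<in> Mor K \<and> dom K g = Z \<and> cod K g = L \<and> \<iota> v \<star> \<iota> g = \<iota> w \<and> \<psi> \<star> \<iota> g = \<phi>"
proof -
  have "(w, \<phi>) \<in> (\<lambda>g. (v \<cdot> g, \<psi> \<lhd> g)) ` hom Z L"
    using assms by (auto simp: lax_descent_object_def bij_betw_def)
  then show ?thesis
    using descent_object_simps[OF assms(1)]
    by (auto simp: hom_iff whisker_right_def id_cell_comp)
qed

lemma descent_mor_eq:
  assumes "lax_descent_object K X L v \<psi>" "\<iota> v \<star> \<iota> g = \<iota> v \<star> \<iota> g'" "\<psi> \<star> \<iota> g = \<psi> \<star> \<iota> g'"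
    "g \<in> Mor K" "g' \<in> Mor K" "dom K g = dom K g'" "cod K g = L" "cod K g' = L"
  shows "g = g'"
proof -
  have "inj_on (\<lambda>g. (v \<cdot> g, \<psi> \<lhd> g)) (hom (dom K g) L)"
    using assms by (auto simp: lax_descent_object_def bij_betw_def)
  moreover have "v \<cdot> g = v \<cdot> g'"
    using assms descent_object_simps[OF assms(1)] by (intro mor_eqI) (auto simp: id_cell_comp)
  ultimately show ?thesis
    using assms by (auto simp: hom_iff inj_on_def whisker_right_def)
qed

lemma descent_cell_factor:
  assumes "lax_descent_object K X L v \<psi>"
    "g \<in> Mor K" "g' \<in> Mor K" "dom K g = dom K g'" "cod K g = L" "cod K g' = L"
    "\<rho> \<in> Cell K" "\<iota> (src K \<rho>) = \<iota> v \<star> \<iota> g" "\<iota> (tgt K \<rho>) = \<iota> v \<star> \<iota> g'"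
    "(\<iota> (cd_l X) \<star> \<rho>) \<bullet> (\<psi> \<star> \<iota> g) = (\<psi> \<star> \<iota> g') \<bullet> (\<iota> (cd_k X) \<star> \<rho>)"
  shows "\<exists>\<theta>. \<theta> \<in> Cell K \<and> src K \<theta> = g \<and> tgt K \<theta> = g' \<and> \<iota> v \<star> \<theta> = \<rho>"
proof -
  note [simp] = descent_object_simps[OF assms(1)]
  have "src K \<rho> = v \<cdot> g" "tgt K \<rho> = v \<cdot> g'"
    using assms by (auto intro!: mor_eqI simp: id_cell_comp)
  then have "\<rho> \<in> descent_pair_morphisms K X (v \<cdot> g, \<psi> \<lhd> g) (v \<cdot> g', \<psi> \<lhd> g')"
    using assms by (auto simp: descent_pair_morphisms_def cells_iff whisker_defs)
  moreover have "g \<in> hom (dom K g) L" "g' \<in> hom (dom K g) L" "dom K g \<in> Obj K"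
    using assms by (auto simp: hom_iff)
  ultimately have "\<rho> \<in> (\<lambda>\<theta>. v \<rhd> \<theta>) ` cells g g'"
    using assms(1) unfolding lax_descent_object_def bij_betw_def by blast
  then show ?thesis
    by (auto simp: cells_iff whisker_left_def)
qed

lemma descent_cell_eq:
  assumes "lax_descent_object K X L v \<psi>" "\<iota> v \<star> \<theta> = \<iota> v \<star> \<theta>'" "\<theta> \<in> Cell K" "\<theta>' \<in> Cell K"
    "\<iota> (src K \<theta>) = \<iota> (src K \<theta>')" "\<iota> (tgt K \<theta>) = \<iota> (tgt K \<theta>')" "cod K (src K \<theta>) = L"
  shows "\<theta> = \<theta>'"
proof -
  have "src K \<theta> \<in> hom (dom K (src K \<theta>)) L" "tgt K \<theta> \<in> hom (dom K (src K \<theta>)) L" "dom K (src K \<theta>) \<in> Obj K"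
    using assms by (auto simp: hom_iff)
  then have "inj_on (\<lambda>\<theta>. v \<rhd> \<theta>) (cells (src K \<theta>) (tgt K \<theta>))"
    using assms(1) unfolding lax_descent_object_def bij_betw_def by blast
  then show ?thesis
    using assms by (auto simp: cells_iff inj_on_def whisker_left_def id_cell_inject)
qed

end

text \<open>Needed to apply preservation of lax descent objects a second time, for \<open>G\<^sup>2\<close>.\<close>

lemma (in two_functor) map_coherence_data_lax:
  assumes "lax_coherence_data C X"
  shows "lax_coherence_data D (map_coherence_data F X)"
  using assms
  by (auto simp: lax_coherence_data_def map_coherence_data_def C.hom_iff D.hom_iff C.cells_iff D.cells_iff)

section \<open>2-adjunctions from universal arrows\<close>

text \<open>The 2-cells of \<open>S\<close> are all those of \<open>K\<close> between morphisms of \<open>S\<close>, so closure only has to be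
checked for objects and morphisms.\<close>

lemma (in two_category) sub_two_category:
  assumes "O\<^sub>0 \<subseteq> Obj K" "M\<^sub>0 \<subseteq> Mor K" "\<And>f. f \<in> M\<^sub>0 \<Longrightarrow> dom K f \<in> O\<^sub>0 \<and> cod K f \<in> O\<^sub>0"
    and "\<And>A. A \<in> O\<^sub>0 \<Longrightarrow> \<one> A \<in> M\<^sub>0"
    and "\<And>f g. f \<in> M\<^sub>0 \<Longrightarrow> g \<in> M\<^sub>0 \<Longrightarrow> dom K g = cod K f \<Longrightarrow> g \<cdot> f \<in> M\<^sub>0"
  defines "S \<equiv> K\<lparr>Obj := O\<^sub>0, Mor := M\<^sub>0, Cell := {\<sigma> \<in> Cell K. src K \<sigma> \<in> M\<^sub>0 \<and> tgt K \<sigma> \<in> M\<^sub>0}\<rparr>"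
  shows "two_category S" "two_functor S K Fid"
proof -
  have in_Mor: "f \<in> M\<^sub>0 \<Longrightarrow> f \<in> Mor K" and in_Obj: "A \<in> O\<^sub>0 \<Longrightarrow> A \<in> Obj K" for f A
    using assms by auto
  have hom: "f \<in> hom\<^bsub>S\<^esub> A B \<longleftrightarrow> f \<in> M\<^sub>0 \<and> f \<in> Mor K \<and> dom K f = A \<and> cod K f = B" for f A B
    using in_Mor by (auto simp: S_def hom_def)
  have cells: "\<sigma> \<in> cells\<^bsub>S\<^esub> f g \<longleftrightarrow> f \<in> M\<^sub>0 \<and> g \<in> M\<^sub>0 \<and> \<sigma> \<in> Cell K \<and> src K \<sigma> = f \<and> tgt K \<sigma> = g" for \<sigma> f g
    by (auto simp: S_def cells_def)
  have sel: "Obj S = O\<^sub>0" "Mor S = M\<^sub>0" "Cell S = {\<sigma> \<in> Cell K. src K \<sigma> \<in> M\<^sub>0 \<and> tgt K \<sigma> \<in> M\<^sub>0}"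
    "dom S = dom K" "cod S = cod K" "src S = src K" "tgt S = tgt K" "id_mor S = id_mor K"
    "id_cell S = id_cell K" "comp S = comp K" "vcomp S = vcomp K" "hcomp S = hcomp K"
    by (simp_all add: S_def)
  show S: "two_category S"
    by unfold_locales (auto simp: sel hom cells assms(3-5) in_Mor in_Obj id_cell_comp interchange')
  interpret S: two_category S by (rule S)
  show "two_functor S K Fid"
    by unfold_locales (auto simp: Fid_def sel hom cells in_Mor in_Obj hom_iff cells_iff)
qed

text \<open>The right adjoint sends \<open>h : B \<rightarrow> B'\<close> to the transpose of \<open>h \<cdot> c B\<close>, a 2-cell \<open>\<sigma>\<close> to the
transpose of its whiskering with \<open>c B\<close>, and the unit at \<open>A\<close> is the transpose of the identity of
\<open>FA\<close>.  All functor laws, the naturality of the unit and the right triangle identity follow by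
cancelling \<open>c\<close>; naturality of \<open>c\<close> and the left triangle identity hold by construction.\<close>

lemma two_adjunction_of_universal_arrows:
  fixes C :: "('o, 'm, 'c) two_cat" and D :: "('p, 'n, 'd) two_cat"
  assumes "two_functor C D F"
    and R\<^sub>0 [simp]: "\<And>B. B \<in> Obj D \<Longrightarrow> R\<^sub>0 B \<in> Obj C"
    and c: "\<And>B. B \<in> Obj D \<Longrightarrow> c B \<in> hom\<^bsub>D\<^esub> (Fo F (R\<^sub>0 B)) B"
    and bij_mor: "\<And>A B. A \<in> Obj C \<Longrightarrow> B \<in> Obj D \<Longrightarrow>
      bij_betw (\<lambda>g. c B \<cdot>\<^bsub>D\<^esub> Fm F g) (hom\<^bsub>C\<^esub> A (R\<^sub>0 B)) (hom\<^bsub>D\<^esub> (Fo F A) B)"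
    and bij_cell: "\<And>A B g g'. A \<in> Obj C \<Longrightarrow> B \<in> Obj D \<Longrightarrow> g \<in> hom\<^bsub>C\<^esub> A (R\<^sub>0 B) \<Longrightarrow> g' \<in> hom\<^bsub>C\<^esub> A (R\<^sub>0 B)
      \<Longrightarrow> bij_betw (\<lambda>\<theta>. c B \<rhd>\<^bsub>D\<^esub> Fc F \<theta>) (cells\<^bsub>C\<^esub> g g') (cells\<^bsub>D\<^esub> (c B \<cdot>\<^bsub>D\<^esub> Fm F g) (c B \<cdot>\<^bsub>D\<^esub> Fm F g'))"
  shows "\<exists>R u. two_adjunction C D F R u c \<and> Fo R = R\<^sub>0"
proof -
  interpret F: two_functor C D F by fact
  have c_simps [simp]: "c B \<in> Mor D" "dom D (c B) = Fo F (R\<^sub>0 B)" "cod D (c B) = B" if "B \<in> Obj D" for B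
    using c[OF that] by (auto simp: hom_def)
  \<comment> \<open>Transposes of morphisms and of 2-cells.\<close>
  define tr where "tr A B = the_inv_into (hom\<^bsub>C\<^esub> A (R\<^sub>0 B)) (\<lambda>g. c B \<cdot>\<^bsub>D\<^esub> Fm F g)" for A B
  define trc where "trc g g' B = the_inv_into (cells\<^bsub>C\<^esub> g g') (\<lambda>\<theta>. \<iota>\<^bsub>D\<^esub> (c B) \<star>\<^bsub>D\<^esub> Fc F \<theta>)" for g g' B
  have tr: "tr A B h \<in> Mor C \<and> dom C (tr A B h) = A \<and> cod C (tr A B h) = R\<^sub>0 B \<and> c B \<cdot>\<^bsub>D\<^esub> Fm F (tr A B h) = h"
    if "h \<in> Mor D" "A \<in> Obj C" "dom D h = Fo F A" "cod D h = B" for A B h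
    using bij_betwE[OF bij_betw_the_inv_into[OF bij_mor[of A B]]]
      f_the_inv_into_f_bij_betw[OF bij_mor[of A B], of h] that
    by (auto simp: tr_def hom_def)
  have mor_eq: "g = g'" if "c B \<cdot>\<^bsub>D\<^esub> Fm F g = c B \<cdot>\<^bsub>D\<^esub> Fm F g'" "g \<in> Mor C" "g' \<in> Mor C" "B \<in> Obj D" "cod C g = R\<^sub>0 B"
    "cod C g' = R\<^sub>0 B" "dom C g = dom C g'" for g g' B
    using bij_betw_imp_inj_on[OF bij_mor[of "dom C g" B]] that by (auto simp: hom_def inj_on_def)
  have trc: "trc g g' B \<sigma> \<in> Cell C \<and> src C (trc g g' B \<sigma>) = g \<and> tgt C (trc g g' B \<sigma>) = g' \<and>
      \<iota>\<^bsub>D\<^esub> (c B) \<star>\<^bsub>D\<^esub> Fc F (trc g g' B \<sigma>) = \<sigma>"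
    if "\<sigma> \<in> Cell D" "src D \<sigma> = c B \<cdot>\<^bsub>D\<^esub> Fm F g" "tgt D \<sigma> = c B \<cdot>\<^bsub>D\<^esub> Fm F g'" "B \<in> Obj D" "g \<in> Mor C" "g' \<in> Mor C"
      "cod C g = R\<^sub>0 B" "cod C g' = R\<^sub>0 B" "dom C g = dom C g'" for g g' B \<sigma>
    using bij_betwE[OF bij_betw_the_inv_into[OF bij_cell[of "dom C g" B g g']]]
      f_the_inv_into_f_bij_betw[OF bij_cell[of "dom C g" B g g'], of \<sigma>] that
    by (auto simp: trc_def hom_def cells_def whisker_left_def)
  have cell_eq: "\<theta> = \<theta>'" if "\<iota>\<^bsub>D\<^esub> (c B) \<star>\<^bsub>D\<^esub> Fc F \<theta> = \<iota>\<^bsub>D\<^esub> (c B) \<star>\<^bsub>D\<^esub> Fc F \<theta>'" "\<theta> \<in> Cell C" "\<theta>' \<in> Cell C"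
    "src C \<theta> = src C \<theta>'" "tgt C \<theta> = tgt C \<theta>'" "B \<in> Obj D" "cod C (src C \<theta>) = R\<^sub>0 B" for \<theta> \<theta>' B
    using bij_betw_imp_inj_on[OF bij_cell[of "dom C (src C \<theta>)" B "src C \<theta>" "tgt C \<theta>"]] that
    by (auto simp: hom_def cells_def inj_on_def whisker_left_def)
  define rm where "rm h = tr (R\<^sub>0 (dom D h)) (cod D h) (h \<cdot>\<^bsub>D\<^esub> c (dom D h))" for h
  define rc where "rc \<sigma> = trc (rm (src D \<sigma>)) (rm (tgt D \<sigma>)) (cod D (src D \<sigma>)) (\<sigma> \<star>\<^bsub>D\<^esub> \<iota>\<^bsub>D\<^esub> (c (dom D (src D \<sigma>))))" for \<sigma>
  define u where "u A = tr A (Fo F A) (\<one>\<^bsub>D\<^esub> (Fo F A))" for A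
  define R where "R = \<lparr>Fo = R\<^sub>0, Fm = rm, Fc = rc\<rparr>"
  have rm [simp]: "rm h \<in> Mor C" "dom C (rm h) = R\<^sub>0 (dom D h)" "cod C (rm h) = R\<^sub>0 (cod D h)"
    and c_rm: "cod D h = B \<Longrightarrow> c B \<cdot>\<^bsub>D\<^esub> Fm F (rm h) = h \<cdot>\<^bsub>D\<^esub> c (dom D h)" if "h \<in> Mor D" for h B
    using tr[of "h \<cdot>\<^bsub>D\<^esub> c (dom D h)" "R\<^sub>0 (dom D h)" "cod D h"] that by (auto simp: rm_def)
  have rc [simp]: "rc \<sigma> \<in> Cell C" "src C (rc \<sigma>) = rm (src D \<sigma>)" "tgt C (rc \<sigma>) = rm (tgt D \<sigma>)"
    and c_rc: "cod D (src D \<sigma>) = B \<Longrightarrow> \<iota>\<^bsub>D\<^esub> (c B) \<star>\<^bsub>D\<^esub> Fc F (rc \<sigma>) = \<sigma> \<star>\<^bsub>D\<^esub> \<iota>\<^bsub>D\<^esub> (c (dom D (src D \<sigma>)))"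
    if "\<sigma> \<in> Cell D" for \<sigma> B
    using trc[of "\<sigma> \<star>\<^bsub>D\<^esub> \<iota>\<^bsub>D\<^esub> (c (dom D (src D \<sigma>)))" "cod D (src D \<sigma>)" "rm (src D \<sigma>)" "rm (tgt D \<sigma>)"] that
    by (auto simp: rc_def c_rm)
  have u [simp]: "u A \<in> Mor C" "dom C (u A) = A" "cod C (u A) = R\<^sub>0 (Fo F A)"
    and c_u: "c (Fo F A) \<cdot>\<^bsub>D\<^esub> Fm F (u A) = \<one>\<^bsub>D\<^esub> (Fo F A)" if "A \<in> Obj C" for A
    using tr[of "\<one>\<^bsub>D\<^esub> (Fo F A)" A "Fo F A"] that by (auto simp: u_def)
  \<comment> \<open>The defining equations of the transposes as rewrite rules on 2-cells, with their tails.\<close>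
  have c_rm_id: "\<iota>\<^bsub>D\<^esub> (c B) \<star>\<^bsub>D\<^esub> Fc F (\<iota>\<^bsub>C\<^esub> (rm h)) = \<iota>\<^bsub>D\<^esub> h \<star>\<^bsub>D\<^esub> \<iota>\<^bsub>D\<^esub> (c (dom D h))"
    if "h \<in> Mor D" "cod D h = B" for h B
    using that c_rm[of h B] by (auto simp: F.D.id_cell_comp[symmetric] F.id_cell_Fm[symmetric])
  have c_u_id: "\<iota>\<^bsub>D\<^esub> (c (Fo F A)) \<star>\<^bsub>D\<^esub> Fc F (\<iota>\<^bsub>C\<^esub> (u A)) = \<iota>\<^bsub>D\<^esub> (\<one>\<^bsub>D\<^esub> (Fo F A))" if "A \<in> Obj C" for A
    using that c_u[of A] by (auto simp: F.D.id_cell_comp[symmetric] F.id_cell_Fm[symmetric])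
  have tails: "\<iota>\<^bsub>D\<^esub> (c B) \<star>\<^bsub>D\<^esub> Fc F (rc \<sigma>) \<star>\<^bsub>D\<^esub> w = \<sigma> \<star>\<^bsub>D\<^esub> \<iota>\<^bsub>D\<^esub> (c (dom D (src D \<sigma>))) \<star>\<^bsub>D\<^esub> w"
    if "\<sigma> \<in> Cell D" "cod D (src D \<sigma>) = B" "w \<in> Cell D" "cod D (src D w) = Fo F (R\<^sub>0 (dom D (src D \<sigma>)))" for \<sigma> B w
    using that by (intro F.D.hcomp_exchange_tail) (auto simp: c_rc)
  have tails2: "\<iota>\<^bsub>D\<^esub> (c B) \<star>\<^bsub>D\<^esub> Fc F (\<iota>\<^bsub>C\<^esub> (rm h)) \<star>\<^bsub>D\<^esub> w = \<iota>\<^bsub>D\<^esub> h \<star>\<^bsub>D\<^esub> \<iota>\<^bsub>D\<^esub> (c (dom D h)) \<star>\<^bsub>D\<^esub> w"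
    if "h \<in> Mor D" "cod D h = B" "w \<in> Cell D" "cod D (src D w) = Fo F (R\<^sub>0 (dom D h))" for h B w
    using that by (intro F.D.hcomp_exchange_tail) (auto simp: c_rm_id)
  have tails3: "\<iota>\<^bsub>D\<^esub> (c (Fo F A)) \<star>\<^bsub>D\<^esub> Fc F (\<iota>\<^bsub>C\<^esub> (u A)) \<star>\<^bsub>D\<^esub> w = w"
    if "A \<in> Obj C" "w \<in> Cell D" "cod D (src D w) = Fo F A" for A w
    using that F.D.hcomp_tail[OF c_u_id, of A w] by auto
  note [simp] = F.D.id_cell_comp F.C.id_cell_comp F.id_cell_Fm c_rm_id c_u_id tails tails2 tails3 c_rc
  have mor_eq': "g = g'" if "\<iota>\<^bsub>D\<^esub> (c B) \<star>\<^bsub>D\<^esub> Fc F (\<iota>\<^bsub>C\<^esub> g) = \<iota>\<^bsub>D\<^esub> (c B) \<star>\<^bsub>D\<^esub> Fc F (\<iota>\<^bsub>C\<^esub> g')" 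
    "g \<in> Mor C" "g' \<in> Mor C" "B \<in> Obj D" "cod C g = R\<^sub>0 B"
    "cod C g' = R\<^sub>0 B" "dom C g = dom C g'" for g g' B
    by (rule mor_eq[of B]; (rule F.D.mor_eqI)?) (use that in auto)
  note hc = F.C.hom_iff F.C.cells_iff F.D.hom_iff F.D.cells_iff
  have R: "two_functor D C R"
  proof (unfold_locales, goal_cases)
    case (4 A) then show ?case by (auto simp: R_def intro!: mor_eq'[of A])
  next
    case (5 f A B g B') then show ?case by (auto simp: R_def hc intro!: mor_eq'[of B'])
  next
    case (6 f) then show ?case by (auto simp: R_def hc intro!: cell_eq[of "cod D f"])
  next
    case (7 \<alpha> f g \<beta> h) then show ?case
      by (auto simp: R_def hc F.C.id_cell_inject F.D.id_cell_inject intro!: cell_eq[of "cod D f"])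
  next
    case (8 f A B \<alpha> f' g B' \<beta> g') then show ?case by (auto simp: R_def hc intro!: cell_eq[of B'] mor_eq'[of B'])
  qed (auto simp: R_def hc)
  interpret R: two_functor D C R by (rule R)
  have "two_natural C C Fid (R \<circ>\<^sub>F F) u"
    by (intro two_natural.intro F.C.two_functor_Fid two_functor_Fcomp[OF F.two_functor_axioms R] two_natural_axioms.intro)
     (auto simp: R_def Fid_def Fcomp_def hc whisker_left_def whisker_right_def intro!: mor_eq'[of "Fo F _"] cell_eq[of "Fo F _"])
  moreover have "two_natural D D (F \<circ>\<^sub>F R) Fid c"
    by (intro two_natural.intro F.D.two_functor_Fid two_functor_Fcomp[OF R F.two_functor_axioms] two_natural_axioms.intro)
     (auto simp: R_def Fid_def Fcomp_def hc whisker_left_def whisker_right_def c_rm)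
  ultimately have "two_adjunction C D F R u c"
    by (intro two_adjunction.intro F.two_functor_axioms R two_adjunction_axioms.intro)
     (auto simp: R_def c_u intro!: mor_eq')
  then show ?thesis by (auto simp: R_def)
qed

section \<open>The 2-category of lax coalgebras\<close>

context two_comonad
begin

lemmas hom_iff = comult.F.C.hom_iff
lemmas cells_iff = comult.F.C.cells_iff
lemmas mor_eqI = comult.F.C.mor_eqI
lemmas id_cell_comp = comult.F.C.id_cell_comp
lemmas id_cell_Fm = comult.F.id_cell_Fm
lemmas interchange' = comult.F.C.interchange'
lemmas hcomp_decompose = comult.F.C.hcomp_decompose
lemmas hcomp_tail = comult.F.C.hcomp_tail
lemmas hcomp_exchange_tail = comult.F.C.hcomp_exchange_tail
lemmas vcomp_tail = comult.F.C.vcomp_tail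
lemmas descent_object_simps = comult.F.C.descent_object_simps
lemmas descent_factor = comult.F.C.descent_factor
lemmas descent_mor_eq = comult.F.C.descent_mor_eq
lemmas descent_cell_factor = comult.F.C.descent_cell_factor
lemmas descent_cell_eq = comult.F.C.descent_cell_eq

lemma Fid_sel [simp]: "Fo Fid = id" "Fm Fid = id" "Fc Fid = id"
  by (simp_all add: Fid_def)

lemma Fcomp_sel [simp]: "Fo (H \<circ>\<^sub>F F) A = Fo H (Fo F A)" "Fm (H \<circ>\<^sub>F F) f = Fm H (Fm F f)"
  "Fc (H \<circ>\<^sub>F F) \<alpha> = Fc H (Fc F \<alpha>)"
  by (simp_all add: Fcomp_def)

lemma d_simps [simp]: "A \<in> Obj K \<Longrightarrow> d A \<in> Mor K" "A \<in> Obj K \<Longrightarrow> dom K (d A) = Fo G A"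
  "A \<in> Obj K \<Longrightarrow> cod K (d A) = Fo G (Fo G A)"
  and e_simps [simp]: "A \<in> Obj K \<Longrightarrow> e A \<in> Mor K" "A \<in> Obj K \<Longrightarrow> dom K (e A) = Fo G A"
  "A \<in> Obj K \<Longrightarrow> cod K (e A) = A"
  using comult.component_in counit.component_in by (auto simp: hom_def)

text \<open>The structure maps \<open>d\<close> and \<open>e\<close> are moved to the left.  In this direction \<open>G\<^sup>2v \<cdot> dL\<close>
becomes \<open>dGA \<cdot> Gv\<close>, and \<open>Gv\<close> can then be evaluated on the coalgebra structure of \<open>L\<close>.\<close>

lemma d_natural: "\<alpha> \<in> Cell K \<Longrightarrow> dom K (src K \<alpha>) = A
    \<Longrightarrow> Fc G (Fc G \<alpha>) \<star> \<iota> (d A) = \<iota> (d (cod K (src K \<alpha>))) \<star> Fc G \<alpha>"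
  and e_natural: "\<alpha> \<in> Cell K \<Longrightarrow> dom K (src K \<alpha>) = A
    \<Longrightarrow> \<alpha> \<star> \<iota> (e A) = \<iota> (e (cod K (src K \<alpha>))) \<star> Fc G \<alpha>"
  using comult.natural_cell[of "src K \<alpha>" A "cod K (src K \<alpha>)" \<alpha> "tgt K \<alpha>"]
    counit.natural_cell[of "src K \<alpha>" A "cod K (src K \<alpha>)" \<alpha> "tgt K \<alpha>"]
  by (auto simp: whisker_left_def whisker_right_def hom_def cells_def)

lemma coassoc_cell: "A \<in> Obj K \<Longrightarrow> Fc G (\<iota> (d A)) \<star> \<iota> (d A) = \<iota> (d (Fo G A)) \<star> \<iota> (d A)"
  and counit_left_cell: "A \<in> Obj K \<Longrightarrow> \<iota> (e (Fo G A)) \<star> \<iota> (d A) = \<iota> (\<one> (Fo G A))"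
  and counit_right_cell: "A \<in> Obj K \<Longrightarrow> Fc G (\<iota> (e A)) \<star> \<iota> (d A) = \<iota> (\<one> (Fo G A))"
  using coassoc counit_left counit_right
  by (simp_all add: id_cell_comp[symmetric] id_cell_Fm[symmetric])

text \<open>\<open>G\<close> is distributed over \<open>\<star>\<close>, so an equation between products does not rewrite its own image
under \<open>G\<close>.  The image is therefore stated separately.\<close>

lemma image_hcomp:
  assumes "x \<star> y = z" "x \<in> Cell K" "y \<in> Cell K" "dom K (src K x) = cod K (src K y)"
  shows "Fc G x \<star> Fc G y = Fc G z"
  using assms by (metis comult.F.Fc_hcomp')

lemma image_hcomp_exchange:
  assumes "x \<star> y = x' \<star> y'" "x \<in> Cell K" "y \<in> Cell K" "dom K (src K x) = cod K (src K y)"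
    "x' \<in> Cell K" "y' \<in> Cell K" "dom K (src K x') = cod K (src K y')"
  shows "Fc G x \<star> Fc G y = Fc G x' \<star> Fc G y'"
  using assms by (metis comult.F.Fc_hcomp')

lemma G_d_natural: "\<alpha> \<in> Cell K \<Longrightarrow> dom K (src K \<alpha>) = A
    \<Longrightarrow> Fc G (Fc G (Fc G \<alpha>)) \<star> Fc G (\<iota> (d A)) = Fc G (\<iota> (d (cod K (src K \<alpha>)))) \<star> Fc G (Fc G \<alpha>)"
  and G_e_natural: "\<alpha> \<in> Cell K \<Longrightarrow> dom K (src K \<alpha>) = A
    \<Longrightarrow> Fc G \<alpha> \<star> Fc G (\<iota> (e A)) = Fc G (\<iota> (e (cod K (src K \<alpha>)))) \<star> Fc G (Fc G \<alpha>)"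
  and G_coassoc_cell: "A \<in> Obj K \<Longrightarrow>
    Fc G (Fc G (\<iota> (d A))) \<star> Fc G (\<iota> (d A)) = Fc G (\<iota> (d (Fo G A))) \<star> Fc G (\<iota> (d A))"
  and G_counit_left_cell: "A \<in> Obj K \<Longrightarrow> Fc G (\<iota> (e (Fo G A))) \<star> Fc G (\<iota> (d A)) = \<iota> (\<one> (Fo G (Fo G A)))"
  and G_counit_right_cell: "A \<in> Obj K \<Longrightarrow> Fc G (Fc G (\<iota> (e A))) \<star> Fc G (\<iota> (d A)) = \<iota> (\<one> (Fo G (Fo G A)))"
      apply (rule image_hcomp_exchange[OF d_natural]; auto)
     apply (rule image_hcomp_exchange[OF e_natural]; auto)
    apply (rule image_hcomp_exchange[OF coassoc_cell]; auto)
   apply (subst image_hcomp[OF counit_left_cell]; auto)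
  apply (subst image_hcomp[OF counit_right_cell]; auto)
  done

lemma pasting_tails:
  "\<lbrakk>\<alpha> \<in> Cell K; dom K (src K \<alpha>) = A; \<beta> \<in> Cell K; cod K (src K \<beta>) = Fo G A\<rbrakk> \<Longrightarrow>
     Fc G (Fc G \<alpha>) \<star> (\<iota> (d A) \<star> \<beta>) = \<iota> (d (cod K (src K \<alpha>))) \<star> (Fc G \<alpha> \<star> \<beta>)"
  "\<lbrakk>\<alpha> \<in> Cell K; dom K (src K \<alpha>) = A; \<beta> \<in> Cell K; cod K (src K \<beta>) = Fo G A\<rbrakk> \<Longrightarrow>
     \<alpha> \<star> (\<iota> (e A) \<star> \<beta>) = \<iota> (e (cod K (src K \<alpha>))) \<star> (Fc G \<alpha> \<star> \<beta>)"
  "\<lbrakk>A \<in> Obj K; \<beta> \<in> Cell K; cod K (src K \<beta>) = Fo G A\<rbrakk> \<Longrightarrow>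
     Fc G (\<iota> (d A)) \<star> (\<iota> (d A) \<star> \<beta>) = \<iota> (d (Fo G A)) \<star> (\<iota> (d A) \<star> \<beta>)"
  "\<lbrakk>A \<in> Obj K; \<beta> \<in> Cell K; cod K (src K \<beta>) = Fo G A\<rbrakk> \<Longrightarrow> \<iota> (e (Fo G A)) \<star> (\<iota> (d A) \<star> \<beta>) = \<beta>"
  "\<lbrakk>A \<in> Obj K; \<beta> \<in> Cell K; cod K (src K \<beta>) = Fo G A\<rbrakk> \<Longrightarrow> Fc G (\<iota> (e A)) \<star> (\<iota> (d A) \<star> \<beta>) = \<beta>"
      apply (rule hcomp_exchange_tail[OF d_natural]; auto)
     apply (rule hcomp_exchange_tail[OF e_natural]; auto)
    apply (rule hcomp_exchange_tail[OF coassoc_cell]; auto)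
   apply (subst hcomp_tail[OF counit_left_cell]; auto)
  apply (subst hcomp_tail[OF counit_right_cell]; auto)
  done

lemma G_pasting_tails:
  "\<lbrakk>\<alpha> \<in> Cell K; dom K (src K \<alpha>) = A; \<beta> \<in> Cell K; cod K (src K \<beta>) = Fo G (Fo G A)\<rbrakk> \<Longrightarrow>
     Fc G (Fc G (Fc G \<alpha>)) \<star> (Fc G (\<iota> (d A)) \<star> \<beta>) = Fc G (\<iota> (d (cod K (src K \<alpha>)))) \<star> (Fc G (Fc G \<alpha>) \<star> \<beta>)"
  "\<lbrakk>\<alpha> \<in> Cell K; dom K (src K \<alpha>) = A; \<beta> \<in> Cell K; cod K (src K \<beta>) = Fo G (Fo G A)\<rbrakk> \<Longrightarrow>
     Fc G \<alpha> \<star> (Fc G (\<iota> (e A)) \<star> \<beta>) = Fc G (\<iota> (e (cod K (src K \<alpha>)))) \<star> (Fc G (Fc G \<alpha>) \<star> \<beta>)"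
  "\<lbrakk>A \<in> Obj K; \<beta> \<in> Cell K; cod K (src K \<beta>) = Fo G (Fo G A)\<rbrakk> \<Longrightarrow>
     Fc G (Fc G (\<iota> (d A))) \<star> (Fc G (\<iota> (d A)) \<star> \<beta>) = Fc G (\<iota> (d (Fo G A))) \<star> (Fc G (\<iota> (d A)) \<star> \<beta>)"
  "\<lbrakk>A \<in> Obj K; \<beta> \<in> Cell K; cod K (src K \<beta>) = Fo G (Fo G A)\<rbrakk> \<Longrightarrow>
     Fc G (\<iota> (e (Fo G A))) \<star> (Fc G (\<iota> (d A)) \<star> \<beta>) = \<beta>"
  "\<lbrakk>A \<in> Obj K; \<beta> \<in> Cell K; cod K (src K \<beta>) = Fo G (Fo G A)\<rbrakk> \<Longrightarrow>
     Fc G (Fc G (\<iota> (e A))) \<star> (Fc G (\<iota> (d A)) \<star> \<beta>) = \<beta>"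
      apply (rule hcomp_exchange_tail[OF G_d_natural]; auto)
     apply (rule hcomp_exchange_tail[OF G_e_natural]; auto)
    apply (rule hcomp_exchange_tail[OF G_coassoc_cell]; auto)
   apply (subst hcomp_tail[OF G_counit_left_cell]; auto)
  apply (subst hcomp_tail[OF G_counit_right_cell]; auto)
  done

lemmas pasting = id_cell_comp id_cell_Fm d_natural e_natural
  coassoc_cell counit_left_cell counit_right_cell G_d_natural G_e_natural
  G_coassoc_cell G_counit_left_cell G_counit_right_cell pasting_tails G_pasting_tails

text \<open>The definitions of coalgebras, morphisms and transformations, in terms of selectors and
\<open>\<star>\<close> instead of constructors and whiskerings.\<close>

lemma lax_coalgebra_iff: "is_lax_coalgebra K G d e X \<longleftrightarrow>
    carrier X \<in> Obj K \<and> structure_mor X \<in> Mor K \<and> dom K (structure_mor X) = carrier X \<and>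
    cod K (structure_mor X) = Fo G (carrier X) \<and> structure_comult X \<in> Cell K \<and>
    src K (structure_comult X) = Fm G (structure_mor X) \<cdot> structure_mor X \<and>
    tgt K (structure_comult X) = d (carrier X) \<cdot> structure_mor X \<and>
    structure_counit X \<in> Cell K \<and> src K (structure_counit X) = \<one> (carrier X) \<and>
    tgt K (structure_counit X) = e (carrier X) \<cdot> structure_mor X \<and>
    (\<iota> (Fm G (d (carrier X))) \<star> structure_comult X) \<bullet> (Fc G (structure_comult X) \<star> \<iota> (structure_mor X))
      = (\<iota> (d (Fo G (carrier X))) \<star> structure_comult X) \<bullet>
        (\<iota> (Fm G (Fm G (structure_mor X))) \<star> structure_comult X) \<and>
    (\<iota> (Fm G (e (carrier X))) \<star> structure_comult X) \<bullet> (Fc G (structure_counit X) \<star> \<iota> (structure_mor X))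
      = \<iota> (structure_mor X) \<and>
    (\<iota> (e (Fo G (carrier X))) \<star> structure_comult X) \<bullet> (\<iota> (structure_mor X) \<star> structure_counit X)
      = \<iota> (structure_mor X)"
  by (cases X) (auto simp: hom_iff cells_iff whisker_left_def whisker_right_def)

lemma lax_morphism_iff: "is_lax_morphism K G d e X Y f f\<^sub>2 \<longleftrightarrow>
    f \<in> Mor K \<and> dom K f = carrier X \<and> cod K f = carrier Y \<and> f\<^sub>2 \<in> Cell K \<and>
    src K f\<^sub>2 = structure_mor Y \<cdot> f \<and> tgt K f\<^sub>2 = Fm G f \<cdot> structure_mor X \<and>
    (\<iota> (d (carrier Y)) \<star> f\<^sub>2) \<bullet> (structure_comult Y \<star> \<iota> f)
      = (\<iota> (Fm G (Fm G f)) \<star> structure_comult X) \<bullet> (Fc G f\<^sub>2 \<star> \<iota> (structure_mor X)) \<bullet>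
        (\<iota> (Fm G (structure_mor Y)) \<star> f\<^sub>2) \<and>
    (\<iota> (e (carrier Y)) \<star> f\<^sub>2) \<bullet> (structure_counit Y \<star> \<iota> f) = \<iota> f \<star> structure_counit X"
  by (cases X; cases Y)
    (auto simp: hom_iff cells_iff whisker_left_def whisker_right_def)

lemma G_transformation_iff: "is_G_transformation K G F H \<rho> \<longleftrightarrow>
    mor_dom F = mor_dom H \<and> mor_cod F = mor_cod H \<and> \<rho> \<in> Cell K \<and> src K \<rho> = mor_under F \<and>
    tgt K \<rho> = mor_under H \<and>
    (Fc G \<rho> \<star> \<iota> (structure_mor (mor_dom F))) \<bullet> mor_cell F
      = mor_cell H \<bullet> (\<iota> (structure_mor (mor_cod F)) \<star> \<rho>)"
  by (cases F; cases H) (auto simp: cells_iff whisker_left_def whisker_right_def)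

declare is_lax_coalgebra.simps [simp del] is_lax_morphism.simps [simp del]
  is_G_transformation.simps [simp del]

lemma coalg_mor_comp_sel [simp]:
  "mor_dom (coalg_mor_comp K G H F) = mor_dom F" "mor_cod (coalg_mor_comp K G H F) = mor_cod H"
  "mor_under (coalg_mor_comp K G H F) = mor_under H \<cdot> mor_under F"
  "mor_cell (coalg_mor_comp K G H F) =
    (\<iota> (Fm G (mor_under H)) \<star> mor_cell F) \<bullet> (mor_cell H \<star> \<iota> (mor_under F))"
  by (cases F; cases H; simp add: whisker_left_def whisker_right_def)+

abbreviation "LC \<equiv> Lax_Coalg K G d e"

lemma LC_sel [simp]:
  "dom LC = mor_dom" "cod LC = mor_cod" "src LC = cell_src" "tgt LC = cell_tgt"
  "id_mor LC X = CoalgMor X X (\<one> (carrier X)) (\<iota> (structure_mor X))"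
  "id_cell LC F = CoalgCell F F (\<iota> (mor_under F))"
  "comp LC = coalg_mor_comp K G"
  "vcomp LC \<tau> \<sigma> = CoalgCell (cell_src \<sigma>) (cell_tgt \<tau>) (cell_under \<tau> \<bullet> cell_under \<sigma>)"
  "hcomp LC \<tau> \<sigma> = CoalgCell (coalg_mor_comp K G (cell_src \<tau>) (cell_src \<sigma>))
      (coalg_mor_comp K G (cell_tgt \<tau>) (cell_tgt \<sigma>)) (cell_under \<tau> \<star> cell_under \<sigma>)"
  by (auto simp: Lax_Coalg_def Let_def)

lemma LC_Obj: "X \<in> Obj LC \<longleftrightarrow> is_lax_coalgebra K G d e X"
  and LC_Mor: "F \<in> Mor LC \<longleftrightarrow> mor_dom F \<in> Obj LC \<and> mor_cod F \<in> Obj LC \<and>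
     is_lax_morphism K G d e (mor_dom F) (mor_cod F) (mor_under F) (mor_cell F)"
  and LC_Cell: "\<sigma> \<in> Cell LC \<longleftrightarrow> cell_src \<sigma> \<in> Mor LC \<and> cell_tgt \<sigma> \<in> Mor LC \<and>
     is_G_transformation K G (cell_src \<sigma>) (cell_tgt \<sigma>) (cell_under \<sigma>)"
  by (auto simp: Lax_Coalg_def Let_def)

lemma LC_Obj_simps [simp]:
  assumes "X \<in> Obj LC"
  shows "carrier X \<in> Obj K" "structure_mor X \<in> Mor K" "dom K (structure_mor X) = carrier X"
    "cod K (structure_mor X) = Fo G (carrier X)" "structure_comult X \<in> Cell K"
    "src K (structure_comult X) = Fm G (structure_mor X) \<cdot> structure_mor X"
    "tgt K (structure_comult X) = d (carrier X) \<cdot> structure_mor X"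
    "structure_counit X \<in> Cell K" "src K (structure_counit X) = \<one> (carrier X)"
    "tgt K (structure_counit X) = e (carrier X) \<cdot> structure_mor X"
  using assms by (auto simp: LC_Obj lax_coalgebra_iff)

lemma LC_Mor_simps [simp]:
  assumes "F \<in> Mor LC"
  shows "mor_dom F \<in> Obj LC" "mor_cod F \<in> Obj LC" "mor_under F \<in> Mor K"
    "dom K (mor_under F) = carrier (mor_dom F)" "cod K (mor_under F) = carrier (mor_cod F)"
    "mor_cell F \<in> Cell K" "src K (mor_cell F) = structure_mor (mor_cod F) \<cdot> mor_under F"
    "tgt K (mor_cell F) = Fm G (mor_under F) \<cdot> structure_mor (mor_dom F)"
  using assms by (auto simp: LC_Mor lax_morphism_iff)

lemma LC_Cell_simps [simp]:
  assumes "\<sigma> \<in> Cell LC"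
  shows "cell_src \<sigma> \<in> Mor LC" "cell_tgt \<sigma> \<in> Mor LC" "mor_dom (cell_tgt \<sigma>) = mor_dom (cell_src \<sigma>)"
    "mor_cod (cell_tgt \<sigma>) = mor_cod (cell_src \<sigma>)" "cell_under \<sigma> \<in> Cell K"
    "src K (cell_under \<sigma>) = mor_under (cell_src \<sigma>)" "tgt K (cell_under \<sigma>) = mor_under (cell_tgt \<sigma>)"
  using assms by (auto simp: LC_Cell G_transformation_iff)

lemma lax_morphism_identity:
  assumes "is_lax_coalgebra K G d e X"
  shows "is_lax_morphism K G d e X X (\<one> (carrier X)) (\<iota> (structure_mor X))"
  using assms unfolding lax_coalgebra_iff lax_morphism_iff
  by (auto simp: pasting)

text \<open>The coassociativity axiom for the composite is pasted from the axiom for \<open>f\<close>, whiskered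
with \<open>G\<^sup>2g\<close> (\<open>E1\<close>), and the axiom for \<open>g\<close>, whiskered with \<open>f\<close> (\<open>E2\<close>).  Between them \<open>Gg\<^sub>2\<close>
and \<open>f\<^sub>2\<close> have to be interchanged (\<open>E3\<close>).\<close>

lemma lax_morphism_comp:
  assumes "is_lax_coalgebra K G d e X" "is_lax_coalgebra K G d e Y" "is_lax_coalgebra K G d e Z"
    and f: "is_lax_morphism K G d e X Y f f\<^sub>2" and g: "is_lax_morphism K G d e Y Z g g\<^sub>2"
  shows "is_lax_morphism K G d e X Z (g \<cdot> f) ((\<iota> (Fm G g) \<star> f\<^sub>2) \<bullet> (g\<^sub>2 \<star> \<iota> f))"
proof -
  have [simp]: "X \<in> Obj LC" "Y \<in> Obj LC" "Z \<in> Obj LC"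
    using assms by (simp_all add: LC_Obj)
  obtain a b c \<alpha> \<beta> \<gamma> \<alpha>\<^sub>0 \<beta>\<^sub>0 \<gamma>\<^sub>0 where
    defs: "a = structure_mor X" "b = structure_mor Y" "c = structure_mor Z"
    "\<alpha> = structure_comult X" "\<beta> = structure_comult Y" "\<gamma> = structure_comult Z"
    "\<alpha>\<^sub>0 = structure_counit X" "\<beta>\<^sub>0 = structure_counit Y" "\<gamma>\<^sub>0 = structure_counit Z"
    by simp
  have [simp]: "a \<in> Mor K" "dom K a = carrier X" "cod K a = Fo G (carrier X)"
    "b \<in> Mor K" "dom K b = carrier Y" "cod K b = Fo G (carrier Y)"
    "c \<in> Mor K" "dom K c = carrier Z" "cod K c = Fo G (carrier Z)"
    "\<alpha> \<in> Cell K" "src K \<alpha> = Fm G a \<cdot> a" "tgt K \<alpha> = d (carrier X) \<cdot> a"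
    "\<beta> \<in> Cell K" "src K \<beta> = Fm G b \<cdot> b" "tgt K \<beta> = d (carrier Y) \<cdot> b"
    "\<gamma> \<in> Cell K" "src K \<gamma> = Fm G c \<cdot> c" "tgt K \<gamma> = d (carrier Z) \<cdot> c"
    "\<alpha>\<^sub>0 \<in> Cell K" "src K \<alpha>\<^sub>0 = \<one> (carrier X)" "tgt K \<alpha>\<^sub>0 = e (carrier X) \<cdot> a"
    "\<beta>\<^sub>0 \<in> Cell K" "src K \<beta>\<^sub>0 = \<one> (carrier Y)" "tgt K \<beta>\<^sub>0 = e (carrier Y) \<cdot> b"
    "\<gamma>\<^sub>0 \<in> Cell K" "src K \<gamma>\<^sub>0 = \<one> (carrier Z)" "tgt K \<gamma>\<^sub>0 = e (carrier Z) \<cdot> c"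
    by (simp_all add: defs)
  note f = f[unfolded lax_morphism_iff, folded defs] and g = g[unfolded lax_morphism_iff, folded defs]
  note [simp] = f[THEN conjunct1] g[THEN conjunct1]
  have [simp]: "dom K f = carrier X" "cod K f = carrier Y" "dom K g = carrier Y" "cod K g = carrier Z"
    "f\<^sub>2 \<in> Cell K" "src K f\<^sub>2 = b \<cdot> f" "tgt K f\<^sub>2 = Fm G f \<cdot> a"
    "g\<^sub>2 \<in> Cell K" "src K g\<^sub>2 = c \<cdot> g" "tgt K g\<^sub>2 = Fm G g \<cdot> b"
    using f g by auto
  have E1: "\<iota> (Fm G (Fm G g)) \<star> ((\<iota> (d (carrier Y)) \<star> f\<^sub>2) \<bullet> (\<beta> \<star> \<iota> f))
     = \<iota> (Fm G (Fm G g)) \<star> ((\<iota> (Fm G (Fm G f)) \<star> \<alpha>) \<bullet> (Fc G f\<^sub>2 \<star> \<iota> a) \<bullet> (\<iota> (Fm G b) \<star> f\<^sub>2))"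
    using f by simp
  have E2: "((\<iota> (d (carrier Z)) \<star> g\<^sub>2) \<bullet> (\<gamma> \<star> \<iota> g)) \<star> \<iota> f
     = ((\<iota> (Fm G (Fm G g)) \<star> \<beta>) \<bullet> (Fc G g\<^sub>2 \<star> \<iota> b) \<bullet> (\<iota> (Fm G c) \<star> g\<^sub>2)) \<star> \<iota> f"
    using g by simp
  have E3: "(\<iota> (Fm G (Fm G g)) \<star> \<iota> (Fm G b) \<star> f\<^sub>2) \<bullet> (Fc G g\<^sub>2 \<star> \<iota> (b \<cdot> f))
     = (Fc G g\<^sub>2 \<star> \<iota> (Fm G f \<cdot> a)) \<bullet> (\<iota> (Fm G c) \<star> \<iota> (Fm G g) \<star> f\<^sub>2)"
    using hcomp_decompose[of f\<^sub>2 "Fc G g\<^sub>2"] by (simp add: pasting)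
  have E4: "\<iota> g \<star> ((\<iota> (e (carrier Y)) \<star> f\<^sub>2) \<bullet> (\<beta>\<^sub>0 \<star> \<iota> f)) = \<iota> g \<star> \<iota> f \<star> \<alpha>\<^sub>0"
    using f by simp
  have E5: "((\<iota> (e (carrier Z)) \<star> g\<^sub>2) \<bullet> (\<gamma>\<^sub>0 \<star> \<iota> g)) \<star> \<iota> f = (\<iota> g \<star> \<beta>\<^sub>0) \<star> \<iota> f"
    using g by simp
  note pasting [simp]
  note E1' = vcomp_tail[OF E1[simplified], of "(Fc G g\<^sub>2 \<star> \<iota> b \<star> \<iota> f) \<bullet> (\<iota> (Fm G c) \<star> g\<^sub>2 \<star> \<iota> f)", simplified]
  note E3' = vcomp_tail[OF E3[simplified], of "\<iota> (Fm G c) \<star> g\<^sub>2 \<star> \<iota> f", simplified]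
  show ?thesis unfolding lax_morphism_iff defs[symmetric]
    using E1' E2[simplified] E3' E4[simplified] E5[simplified] by simp
qed

lemma G_transformation_identity:
  assumes "F \<in> Mor LC"
  shows "is_G_transformation K G F F (\<iota> (mor_under F))"
  using assms by (simp add: G_transformation_iff pasting)

lemma G_transformation_vcomp:
  assumes [simp]: "F \<in> Mor LC" "F' \<in> Mor LC" "F'' \<in> Mor LC"
    and \<rho>: "is_G_transformation K G F F' \<rho>" and \<sigma>: "is_G_transformation K G F' F'' \<sigma>"
  shows "is_G_transformation K G F F'' (\<sigma> \<bullet> \<rho>)"
proof -
  let ?a = "structure_mor (mor_dom F)" and ?b = "structure_mor (mor_cod F)"
  have [simp]: "mor_dom F' = mor_dom F" "mor_cod F' = mor_cod F" "mor_dom F'' = mor_dom F"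
    "mor_cod F'' = mor_cod F" "\<rho> \<in> Cell K" "src K \<rho> = mor_under F" "tgt K \<rho> = mor_under F'"
    "\<sigma> \<in> Cell K" "src K \<sigma> = mor_under F'" "tgt K \<sigma> = mor_under F''"
    using \<rho> \<sigma> by (auto simp: G_transformation_iff)
  note [simp] = pasting
  have E1: "(Fc G \<rho> \<star> \<iota> ?a) \<bullet> mor_cell F = mor_cell F' \<bullet> (\<iota> ?b \<star> \<rho>)"
    and E2: "(Fc G \<sigma> \<star> \<iota> ?a) \<bullet> mor_cell F' = mor_cell F'' \<bullet> (\<iota> ?b \<star> \<sigma>)"
    using \<rho> \<sigma> by (auto simp: G_transformation_iff)
  show ?thesis
    using E1 vcomp_tail[OF E2, of "\<iota> ?b \<star> \<rho>"] by (simp add: G_transformation_iff)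
qed

text \<open>Split the horizontal composite as \<open>\<sigma> \<cdot> f'\<close> after \<open>g \<cdot> \<rho>\<close>, use the two transformation laws
(\<open>E1\<close>, \<open>E2\<close>), and let \<open>\<sigma>\<close> pass the structure cell of \<open>F'\<close> and \<open>\<rho>\<close> pass that of \<open>H\<close>
(\<open>d2\<close>, \<open>d3\<close>).\<close>

lemma G_transformation_hcomp:
  assumes [simp]: "F \<in> Mor LC" "F' \<in> Mor LC" "H \<in> Mor LC" "H' \<in> Mor LC" "mor_dom H = mor_cod F"
    and \<rho>: "is_G_transformation K G F F' \<rho>" and \<sigma>: "is_G_transformation K G H H' \<sigma>"
  shows "is_G_transformation K G (coalg_mor_comp K G H F) (coalg_mor_comp K G H' F') (\<sigma> \<star> \<rho>)"
proof -
  define a b c where "a = structure_mor (mor_dom F)" and "b = structure_mor (mor_cod F)"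
    and "c = structure_mor (mor_cod H)"
  define f f' g g' where "f = mor_under F" and "f' = mor_under F'" and "g = mor_under H"
    and "g' = mor_under H'"
  note defs = a_def b_def c_def f_def f'_def g_def g'_def
  have [simp]: "mor_dom F' = mor_dom F" "mor_cod F' = mor_cod F" "mor_dom H' = mor_cod F"
    "mor_cod H' = mor_cod H" "\<rho> \<in> Cell K" "src K \<rho> = f" "tgt K \<rho> = f'"
    "\<sigma> \<in> Cell K" "src K \<sigma> = g" "tgt K \<sigma> = g'"
    using \<rho> \<sigma> by (auto simp: G_transformation_iff defs)
  have [simp]: "f \<in> Mor K"  "f' \<in> Mor K" "g \<in> Mor K"  "g' \<in> Mor K" "a \<in> Mor K" "b \<in> Mor K" "c \<in> Mor K"
    "dom K f = carrier (mor_dom F)" "dom K f' = carrier (mor_dom F)"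
    "cod K f = carrier (mor_cod F)" "cod K f' = carrier (mor_cod F)" 
    "dom K g = carrier (mor_cod F)" "dom K g' = carrier (mor_cod F)"
    "cod K g = carrier (mor_cod H)" "cod K g' = carrier (mor_cod H)" 
    "dom K a = carrier (mor_dom F)" "cod K a = Fo G (carrier (mor_dom F))"
    "dom K b = carrier (mor_cod F)" "cod K b = Fo G (carrier (mor_cod F))"
    "dom K c = carrier (mor_cod H)" "cod K c = Fo G (carrier (mor_cod H))"
    "src K (mor_cell F) = b \<cdot> f" "tgt K (mor_cell F) = Fm G f \<cdot> a"
    "src K (mor_cell F') = b \<cdot> f'" "tgt K (mor_cell F') = Fm G f' \<cdot> a"
    "src K (mor_cell H) = c \<cdot> g" "tgt K (mor_cell H) = Fm G g \<cdot> b"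
    "src K (mor_cell H') = c \<cdot> g'" "tgt K (mor_cell H') = Fm G g' \<cdot> b"
    by (simp_all add: defs)
  have \<rho>': "(Fc G \<rho> \<star> \<iota> a) \<bullet> mor_cell F = mor_cell F' \<bullet> (\<iota> b \<star> \<rho>)"
    and \<sigma>': "(Fc G \<sigma> \<star> \<iota> b) \<bullet> mor_cell H = mor_cell H' \<bullet> (\<iota> c \<star> \<sigma>)"
    using \<rho> \<sigma> by (auto simp: G_transformation_iff defs)
  note [simp] = pasting
  note vcomp_tail = vcomp_tail and decompose = hcomp_decompose
  have E1: "\<iota> (Fm G g) \<star> ((Fc G \<rho> \<star> \<iota> a) \<bullet> mor_cell F) = \<iota> (Fm G g) \<star> (mor_cell F' \<bullet> (\<iota> b \<star> \<rho>))"
    and E2: "((Fc G \<sigma> \<star> \<iota> b) \<bullet> mor_cell H) \<star> \<iota> f' = (mor_cell H' \<bullet> (\<iota> c \<star> \<sigma>)) \<star> \<iota> f'"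
    by (simp_all only: \<rho>' \<sigma>')
  have d1: "\<sigma> \<star> \<rho> = (\<sigma> \<star> \<iota> f') \<bullet> (\<iota> g \<star> \<rho>)"
    using decompose(1)[of \<rho> \<sigma>] by simp
  have d2: "(\<iota> (Fm G g') \<star> mor_cell F') \<bullet> (Fc G \<sigma> \<star> \<iota> b \<star> \<iota> f')
      = (Fc G \<sigma> \<star> Fc G (\<iota> f') \<star> \<iota> a) \<bullet> (\<iota> (Fm G g) \<star> mor_cell F')"
    using decompose[of "mor_cell F'" "Fc G \<sigma>"] by simp
  have d3: "(mor_cell H \<star> \<iota> f') \<bullet> (\<iota> c \<star> \<iota> g \<star> \<rho>) = (\<iota> (Fm G g) \<star> \<iota> b \<star> \<rho>) \<bullet> (mor_cell H \<star> \<iota> f)"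
    using decompose[of \<rho> "mor_cell H"] by simp
  note E1' = vcomp_tail[OF E1[simplified], of "mor_cell H \<star> \<iota> f", simplified]
    and E2' = vcomp_tail[OF E2[simplified], of "\<iota> c \<star> \<iota> g \<star> \<rho>", simplified]
    and d2' = vcomp_tail[OF d2[simplified], of "(mor_cell H \<star> \<iota> f') \<bullet> (\<iota> c \<star> \<iota> g \<star> \<rho>)", simplified]
  have "(Fc G (\<sigma> \<star> \<rho>) \<star> \<iota> a) \<bullet> ((\<iota> (Fm G g) \<star> mor_cell F) \<bullet> (mor_cell H \<star> \<iota> f))
      = ((\<iota> (Fm G g') \<star> mor_cell F') \<bullet> (mor_cell H' \<star> \<iota> f')) \<bullet> (\<iota> c \<star> \<sigma> \<star> \<rho>)"
    unfolding d1 using E1' E2'[symmetric] d2' d3[simplified] by simp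
  then show ?thesis
    by (simp add: G_transformation_iff defs)
qed

lemma LC_id_mor [simp]: "X \<in> Obj LC \<Longrightarrow> CoalgMor X X (\<one> (carrier X)) (\<iota> (structure_mor X)) \<in> Mor LC"
  by (simp add: LC_Mor lax_morphism_identity[folded LC_Obj])

lemma LC_comp [simp]:
  "\<lbrakk>F \<in> Mor LC; H \<in> Mor LC; mor_dom H = mor_cod F\<rbrakk> \<Longrightarrow> coalg_mor_comp K G H F \<in> Mor LC"
  using lax_morphism_comp[of "mor_dom F" "mor_cod F" "mor_cod H" "mor_under F" "mor_cell F" "mor_under H" "mor_cell H"]
  by (simp add: LC_Mor LC_Obj)

text \<open>Restricted to constructor terms, this equivalence can be used for rewriting without
reproducing its own left-hand side.\<close>

lemma LC_CoalgCell: "CoalgCell F H \<rho> \<in> Cell LC \<longleftrightarrow>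
    F \<in> Mor LC \<and> H \<in> Mor LC \<and> is_G_transformation K G F H \<rho>"
  by (subst LC_Cell) simp

lemma LC_comp_id [simp]:
  assumes "F \<in> Mor LC"
  shows "mor_cod F = Y \<Longrightarrow> coalg_mor_comp K G (CoalgMor Y Y (\<one> (carrier Y)) (\<iota> (structure_mor Y))) F = F"
    and "mor_dom F = X \<Longrightarrow> coalg_mor_comp K G F (CoalgMor X X (\<one> (carrier X)) (\<iota> (structure_mor X))) = F"
  using assms by (auto intro!: coalg_mor.expand simp: pasting)

lemma LC_comp_assoc [simp]:
  "\<lbrakk>F \<in> Mor LC; H \<in> Mor LC; J \<in> Mor LC; mor_dom H = mor_cod F; mor_dom J = mor_cod H\<rbrakk> \<Longrightarrow>
    coalg_mor_comp K G (coalg_mor_comp K G J H) F = coalg_mor_comp K G J (coalg_mor_comp K G H F)"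
  by (auto intro!: coalg_mor.expand simp: pasting)

lemma two_category_LC: "two_category LC"
proof -
  note [simp] = pasting
  have G: "is_G_transformation K G (cell_src \<sigma>) (cell_tgt \<sigma>) (cell_under \<sigma>)" if "\<sigma> \<in> Cell LC" for \<sigma>
    using that LC_Cell by blast
  have hom: "F \<in> Mor LC \<and> mor_dom F = X \<and> mor_cod F = Y" if "F \<in> hom\<^bsub>LC\<^esub> X Y" for F X Y
    using that by (simp add: hom_def)
  have cell: "\<sigma> \<in> Cell LC \<and> cell_src \<sigma> = F \<and> cell_tgt \<sigma> = H" if "\<sigma> \<in> cells\<^bsub>LC\<^esub> F H" for \<sigma> F H
    using that by (simp add: cells_def)
  note [dest!] = hom cell
  show ?thesis
  proof (unfold_locales, goal_cases)
    case 1 then show ?case by simp next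
    case 2 then show ?case by simp next
    case 3 then show ?case by (simp add: hom_def) next
    case 4 then show ?case by (auto simp: hom_def) next
    case 5 then show ?case by auto next
    case 6 then show ?case by auto next
    case 7 then show ?case by auto next
    case 8 then show ?case by simp next
    case 9 then show ?case by simp next
    case 10 then show ?case by simp next
    case 11 then show ?case by simp next
    case 12 then show ?case by (simp add: cells_def LC_CoalgCell G_transformation_identity) next
    case (13 \<alpha> f g \<beta> h)
    then show ?case using G[of \<alpha>] G[of \<beta>]
      by (auto simp: cells_def LC_CoalgCell intro!: G_transformation_vcomp[where F' = "cell_tgt \<alpha>"])
  next
    case 14 then show ?case by - (rule coalg_cell.expand, auto) next
    case 15 then show ?case by - (rule coalg_cell.expand, auto) next
    case 16 then show ?case by - (rule coalg_cell.expand, auto)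
  next
    case (17 f A B \<alpha> f' g C \<beta> g')
    then show ?case using G[of \<alpha>] G[of \<beta>]
      by (auto simp: cells_def LC_CoalgCell intro!: G_transformation_hcomp)
  next
    case 18 then show ?case by - (rule coalg_cell.expand, auto) next
    case 19 then show ?case by - (rule coalg_cell.expand, auto) next
    case 20 then show ?case by - (rule coalg_cell.expand, auto) next
    case 21 then show ?case by - (rule coalg_cell.expand, auto) next
    case 22 then show ?case by - (rule coalg_cell.expand, auto simp: interchange')
  qed
qed

end

section \<open>The Eilenberg--Moore 2-category\<close>

context two_comonad
begin

abbreviation "EMC \<equiv> EM K G d e"

lemma EM_sel [simp]:
  "dom EMC = mor_dom" "cod EMC = mor_cod" "src EMC = cell_src" "tgt EMC = cell_tgt"
  "id_mor EMC = id_mor LC" "id_cell EMC = id_cell LC" "comp EMC = comp LC" "vcomp EMC = vcomp LC"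
  "hcomp EMC = hcomp LC"
  unfolding EM_def Let_def by simp_all

lemma EM_Obj: "Y \<in> Obj EMC \<longleftrightarrow> Y \<in> Obj LC \<and> is_strict_coalgebra K G d e Y"
  and EM_Mor: "F \<in> Mor EMC \<longleftrightarrow> F \<in> Mor LC \<and> mor_dom F \<in> Obj EMC \<and> mor_cod F \<in> Obj EMC \<and>
    mor_cell F = \<iota> (structure_mor (mor_cod F) \<cdot> mor_under F)"
  and EM_Cell: "\<sigma> \<in> Cell EMC \<longleftrightarrow> \<sigma> \<in> Cell LC \<and> cell_src \<sigma> \<in> Mor EMC \<and> cell_tgt \<sigma> \<in> Mor EMC"
  by (auto simp: EM_def Let_def)

lemma is_strict_coalgebra_iff: "is_strict_coalgebra K G d e Y \<longleftrightarrow> is_lax_coalgebra K G d e Y \<and>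
    structure_comult Y = \<iota> (Fm G (structure_mor Y) \<cdot> structure_mor Y) \<and>
    structure_counit Y = \<iota> (\<one> (carrier Y))"
  by (cases Y) auto

declare is_strict_coalgebra.simps [simp del]

text \<open>The structure 2-cells of a strict coalgebra are identities of the prescribed source; reading
off their target gives the strict coassociativity and counit equations.\<close>

lemma EM_Obj_simps:
  assumes "Y \<in> Obj EMC"
  shows "Y \<in> Obj LC" "structure_comult Y = \<iota> (Fm G (structure_mor Y) \<cdot> structure_mor Y)"
    "structure_counit Y = \<iota> (\<one> (carrier Y))"
    "Fc G (\<iota> (structure_mor Y)) \<star> \<iota> (structure_mor Y) = \<iota> (d (carrier Y)) \<star> \<iota> (structure_mor Y)"
    "\<iota> (e (carrier Y)) \<star> \<iota> (structure_mor Y) = \<iota> (\<one> (carrier Y))"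
proof -
  show Y [simp]: "Y \<in> Obj LC" and s: "structure_comult Y = \<iota> (Fm G (structure_mor Y) \<cdot> structure_mor Y)"
    "structure_counit Y = \<iota> (\<one> (carrier Y))"
    using assms by (auto simp: EM_Obj is_strict_coalgebra_iff)
  have "Fm G (structure_mor Y) \<cdot> structure_mor Y = d (carrier Y) \<cdot> structure_mor Y"
    using LC_Obj_simps(7)[OF Y] s by simp
  from arg_cong[OF this, of "id_cell K"] show
    "Fc G (\<iota> (structure_mor Y)) \<star> \<iota> (structure_mor Y) = \<iota> (d (carrier Y)) \<star> \<iota> (structure_mor Y)"
    by (simp add: id_cell_comp id_cell_Fm)
  have "\<one> (carrier Y) = e (carrier Y) \<cdot> structure_mor Y"
    using LC_Obj_simps(10)[OF Y] s by simp
  from arg_cong[OF this, of "id_cell K"] show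
    "\<iota> (e (carrier Y)) \<star> \<iota> (structure_mor Y) = \<iota> (\<one> (carrier Y))"
    by (simp add: id_cell_comp)
qed

text \<open>As for objects: the structure cell is the identity of its source, so source and target of the
cell agree.\<close>

lemma EM_Mor_strict:
  assumes "F \<in> Mor EMC"
  shows "Fc G (\<iota> (mor_under F)) \<star> \<iota> (structure_mor (mor_dom F))
    = \<iota> (structure_mor (mor_cod F)) \<star> \<iota> (mor_under F)"
proof -
  have [simp]: "F \<in> Mor LC" and s: "mor_cell F = \<iota> (structure_mor (mor_cod F) \<cdot> mor_under F)"
    using assms by (auto simp: EM_Mor)
  have "Fm G (mor_under F) \<cdot> structure_mor (mor_dom F) = structure_mor (mor_cod F) \<cdot> mor_under F"
    using LC_Mor_simps(8)[of F] s by simp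
  from arg_cong[OF this, of "id_cell K"] show ?thesis
    by (simp add: id_cell_comp id_cell_Fm)
qed

lemma strict_object_in_EM:
  assumes "L \<in> Obj K" "b \<in> Mor K" "dom K b = L" "cod K b = Fo G L"
    and "Fc G (\<iota> b) \<star> \<iota> b = \<iota> (d L) \<star> \<iota> b" "\<iota> (e L) \<star> \<iota> b = \<iota> (\<one> L)"
  shows "Coalg L b (\<iota> (Fm G b \<cdot> b)) (\<iota> (\<one> L)) \<in> Obj EMC"
proof -
  note [simp] = assms(1-6) pasting hcomp_exchange_tail[OF assms(5)]
  have "Fm G b \<cdot> b = d L \<cdot> b" "e L \<cdot> b = \<one> L"
    by (auto intro!: mor_eqI)
  then show ?thesis
    by (auto simp: EM_Obj LC_Obj is_strict_coalgebra_iff lax_coalgebra_iff)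
qed

lemma EM_Obj_tails:
  assumes "Y \<in> Obj EMC" "w \<in> Cell K" "cod K (src K w) = carrier Y"
  shows "Fc G (\<iota> (structure_mor Y)) \<star> \<iota> (structure_mor Y) \<star> w = \<iota> (d (carrier Y)) \<star> \<iota> (structure_mor Y) \<star> w"
    "\<iota> (e (carrier Y)) \<star> \<iota> (structure_mor Y) \<star> w = w"
proof -
  note [simp] = EM_Obj_simps[OF assms(1)] assms(2,3)
  show "Fc G (\<iota> (structure_mor Y)) \<star> \<iota> (structure_mor Y) \<star> w = \<iota> (d (carrier Y)) \<star> \<iota> (structure_mor Y) \<star> w"
    by (rule hcomp_exchange_tail) simp_all
  show "\<iota> (e (carrier Y)) \<star> \<iota> (structure_mor Y) \<star> w = w"
    using hcomp_tail[OF EM_Obj_simps(5)[OF assms(1)], of w] by simp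
qed

lemma strict_morphism_in_EM:
  assumes "Y \<in> Obj EMC" "Z \<in> Obj EMC" "f \<in> Mor K" "dom K f = carrier Y" "cod K f = carrier Z"
    and "Fc G (\<iota> f) \<star> \<iota> (structure_mor Y) = \<iota> (structure_mor Z) \<star> \<iota> f"
  shows "CoalgMor Y Z f (\<iota> (structure_mor Z \<cdot> f)) \<in> Mor EMC"
proof -
  note [simp] = EM_Obj_simps[OF assms(1)] EM_Obj_simps[OF assms(2)] assms(3-6)
    EM_Obj_tails[OF assms(1)] EM_Obj_tails[OF assms(2)]
  have "Fm G f \<cdot> structure_mor Y = structure_mor Z \<cdot> f"
    using assms by (auto intro!: mor_eqI simp: id_cell_comp id_cell_Fm)
  then show ?thesis
    using assms(1,2)
    by (auto simp: EM_Mor LC_Mor lax_morphism_iff pasting hcomp_exchange_tail[OF assms(6)])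
qed

text \<open>Between strict morphisms both structure cells are identities and drop out of the law for
transformations.\<close>

lemma EM_Cell_iff: "CoalgCell F H \<rho> \<in> Cell EMC \<longleftrightarrow> F \<in> Mor EMC \<and> H \<in> Mor EMC \<and>
   mor_dom F = mor_dom H \<and> mor_cod F = mor_cod H \<and> \<rho> \<in> Cell K \<and> src K \<rho> = mor_under F \<and>
   tgt K \<rho> = mor_under H \<and>
   Fc G \<rho> \<star> \<iota> (structure_mor (mor_dom F)) = \<iota> (structure_mor (mor_cod F)) \<star> \<rho>"
proof -
  have "(Fc G \<rho> \<star> \<iota> (structure_mor (mor_dom F))) \<bullet> mor_cell F = Fc G \<rho> \<star> \<iota> (structure_mor (mor_dom F)) \<and>
    mor_cell H \<bullet> (\<iota> (structure_mor (mor_cod F)) \<star> \<rho>) = \<iota> (structure_mor (mor_cod F)) \<star> \<rho>"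
    if FH: "F \<in> Mor EMC" "H \<in> Mor EMC" and "mor_dom F = mor_dom H" "mor_cod F = mor_cod H"
       "\<rho> \<in> Cell K" "src K \<rho> = mor_under F" "tgt K \<rho> = mor_under H"
  proof -
    have [simp]: "F \<in> Mor LC" "H \<in> Mor LC" using FH by (auto simp: EM_Mor)
    have m: "mor_cell F = \<iota> (structure_mor (mor_cod F) \<cdot> mor_under F)" 
      "mor_cell H = \<iota> (structure_mor (mor_cod H) \<cdot> mor_under H)" using FH by (auto simp: EM_Mor)
    show ?thesis using EM_Mor_strict[OF FH(1)] EM_Mor_strict[OF FH(2)] that
      by (simp add: m pasting)
  qed
  then show ?thesis
    by (auto simp: EM_Cell LC_CoalgCell G_transformation_iff EM_Mor)
qed

lemma two_functor_EM_LC: "two_functor EMC LC Fid"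
proof -
  interpret LC: two_category LC by (rule two_category_LC)
  have EM: "EMC = LC\<lparr>Obj := Obj EMC, Mor := Mor EMC,
    Cell := {\<sigma> \<in> Cell LC. src LC \<sigma> \<in> Mor EMC \<and> tgt LC \<sigma> \<in> Mor EMC}\<rparr>"
    by (simp add: EM_def Let_def)
  have id: "id_mor LC X \<in> Mor EMC" if "X \<in> Obj EMC" for X
    using that EM_Obj_simps[OF that] by (simp add: EM_Mor)
  have comp: "comp LC H F \<in> Mor EMC" if F: "F \<in> Mor EMC" and H: "H \<in> Mor EMC" and [simp]: "mor_dom H = mor_cod F" for H F
  proof -
    have [simp]: "F \<in> Mor LC" "H \<in> Mor LC" using F H by (auto simp: EM_Mor)
    have "Fc G (\<iota> (mor_under H)) \<star> \<iota> (structure_mor (mor_cod F)) \<star> \<iota> (mor_under F)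
        = \<iota> (structure_mor (mor_cod H)) \<star> \<iota> (mor_under H) \<star> \<iota> (mor_under F)"
      using EM_Mor_strict[OF H] by (intro hcomp_exchange_tail) simp_all
    then show ?thesis
      using F H EM_Mor_strict[OF F] by (auto simp: EM_Mor pasting)
  qed
  have sub: "Obj EMC \<subseteq> Obj LC" "Mor EMC \<subseteq> Mor LC"
    "F \<in> Mor EMC \<Longrightarrow> mor_dom F \<in> Obj EMC \<and> mor_cod F \<in> Obj EMC" for F
    by (auto simp: EM_Obj EM_Mor)
  show ?thesis
    using id comp by (subst EM, intro LC.sub_two_category) (simp_all add: sub)
qed

end

section \<open>Strictification of a lax coalgebra\<close>

context two_comonad
begin

text \<open>The component \<open>delta\<close> is the identity of \<open>GeA \<cdot> dA = 1\<close>; \<open>kappa\<close> and \<open>rho\<close> are the identities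
expressing coassociativity of \<open>d\<close> and naturality of \<open>d\<close> at \<open>a\<close>.\<close>

definition coalgebra_data :: "'o \<Rightarrow> 'm \<Rightarrow> 'c \<Rightarrow> 'c \<Rightarrow> ('o, 'm, 'c) coherence_data"
  where "coalgebra_data A a \<alpha> \<alpha>\<^sub>0 =
    \<lparr>X1 = Fo G A, X2 = Fo G (Fo G A), X3 = Fo G (Fo G (Fo G A)),
     cd_k = Fm G a, cd_l = d A, cd_j = Fm G (e A),
     cd_m = d (Fo G A), cd_n = Fm G (d A), cd_r = Fm G (Fm G a),
     cd_gamma = Fc G \<alpha>\<^sub>0, cd_delta = \<iota> (\<one> (Fo G A)), cd_kappa = \<iota> (d (Fo G A) \<cdot> d A),
     cd_lambda = Fc G \<alpha>, cd_rho = \<iota> (Fm G (Fm G a) \<cdot> d A)\<rparr>"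

end

text \<open>Existence and preservation of lax descent objects are used only through these three levels:
\<open>L\<close> itself, \<open>GL\<close> for building the structure map and testing strictness of morphisms, and
\<open>G\<^sup>2L\<close> for testing coassociativity.\<close>

locale coalgebra_descent = two_comonad K G d e
  for K :: "('o, 'm, 'c) two_cat" (structure)
    and G :: "('o, 'm, 'c, 'o, 'm, 'c) two_functor_maps"
    and d e :: "'o \<Rightarrow> 'm" +
  fixes A :: 'o and a :: 'm and \<alpha> \<alpha>\<^sub>0 :: 'c and L :: 'o and v :: 'm and \<psi> :: 'c
  assumes coalgebra: "is_lax_coalgebra K G d e (Coalg A a \<alpha> \<alpha>\<^sub>0)"
    and descent: "lax_descent_object K (coalgebra_data A a \<alpha> \<alpha>\<^sub>0) L v \<psi>"
    and G_descent: "lax_descent_object K (map_coherence_data G (coalgebra_data A a \<alpha> \<alpha>\<^sub>0))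
      (Fo G L) (Fm G v) (Fc G \<psi>)"
    and GG_descent: "lax_descent_object K (map_coherence_data G (map_coherence_data G (coalgebra_data A a \<alpha> \<alpha>\<^sub>0)))
      (Fo G (Fo G L)) (Fm G (Fm G v)) (Fc G (Fc G \<psi>))"
begin

lemma lax_simps [simp]: "A \<in> Obj K" "a \<in> Mor K" "dom K a = A" "cod K a = Fo G A"
  "\<alpha> \<in> Cell K" "src K \<alpha> = Fm G a \<cdot> a" "tgt K \<alpha> = d A \<cdot> a"
  "\<alpha>\<^sub>0 \<in> Cell K" "src K \<alpha>\<^sub>0 = \<one> A" "tgt K \<alpha>\<^sub>0 = e A \<cdot> a"
  using coalgebra[unfolded lax_coalgebra_iff] by auto

lemma coalgebra_in [simp]: "Coalg A a \<alpha> \<alpha>\<^sub>0 \<in> Obj LC"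
  using coalgebra by (simp add: LC_Obj)

lemma lax_laws:
  "(Fc G (\<iota> (d A)) \<star> \<alpha>) \<bullet> (Fc G \<alpha> \<star> \<iota> a) = (\<iota> (d (Fo G A)) \<star> \<alpha>) \<bullet> (Fc G (Fc G (\<iota> a)) \<star> \<alpha>)"
  "(Fc G (\<iota> (e A)) \<star> \<alpha>) \<bullet> (Fc G \<alpha>\<^sub>0 \<star> \<iota> a) = \<iota> a"
  "(\<iota> (e (Fo G A)) \<star> \<alpha>) \<bullet> (\<iota> a \<star> \<alpha>\<^sub>0) = \<iota> a"
  using coalgebra[unfolded lax_coalgebra_iff] by (auto simp: id_cell_Fm)

lemma descent_simps [simp]: "L \<in> Obj K" "v \<in> Mor K" "dom K v = L" "cod K v = Fo G A"
  "\<psi> \<in> Cell K" "src K \<psi> = Fm G a \<cdot> v" "tgt K \<psi> = d A \<cdot> v"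
  using descent_object_simps[OF descent] by (auto simp: coalgebra_data_def)

lemma descent_pair_iff:
  assumes "w \<in> Mor K" "cod K w = Fo G A" "\<phi> \<in> Cell K" "src K \<phi> = Fm G a \<cdot> w" "tgt K \<phi> = d A \<cdot> w"
  shows "(w, \<phi>) \<in> descent_pairs K (coalgebra_data A a \<alpha> \<alpha>\<^sub>0) (dom K w) \<longleftrightarrow>
    (\<iota> (d (Fo G A)) \<star> \<phi>) \<bullet> (Fc G (Fc G (\<iota> a)) \<star> \<phi>) = (Fc G (\<iota> (d A)) \<star> \<phi>) \<bullet> (Fc G \<alpha> \<star> \<iota> w) \<and>
    (Fc G (\<iota> (e A)) \<star> \<phi>) \<bullet> (Fc G \<alpha>\<^sub>0 \<star> \<iota> w) = \<iota> w"
  using assms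
  by (simp add: coalgebra_data_def descent_pairs_def hom_iff cells_iff whisker_left_def whisker_right_def pasting)

lemma descent_laws:
  "(\<iota> (d (Fo G A)) \<star> \<psi>) \<bullet> (Fc G (Fc G (\<iota> a)) \<star> \<psi>) = (Fc G (\<iota> (d A)) \<star> \<psi>) \<bullet> (Fc G \<alpha> \<star> \<iota> v)"
  "(Fc G (\<iota> (e A)) \<star> \<psi>) \<bullet> (Fc G \<alpha>\<^sub>0 \<star> \<iota> v) = \<iota> v"
  using descent_object_simps(8)[OF descent] descent_pair_iff[of v \<psi>] by auto

text \<open>The descent equations for \<open>(dA \<cdot> v, dGA \<cdot> \<psi>)\<close> are those for \<open>(v, \<psi>)\<close> whiskered with \<open>dG\<^sup>2A\<close>
and \<open>dA\<close>, up to naturality of \<open>d\<close>.\<close>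

lemma ex_strict_structure:
  "\<exists>a'. a' \<in> Mor K \<and> dom K a' = L \<and> cod K a' = Fo G L \<and>
    Fc G (\<iota> v) \<star> \<iota> a' = \<iota> (d A) \<star> \<iota> v \<and> Fc G \<psi> \<star> \<iota> a' = \<iota> (d (Fo G A)) \<star> \<psi>"
proof -
  have "\<iota> (d (Fo G (Fo G A))) \<star> ((\<iota> (d (Fo G A)) \<star> \<psi>) \<bullet> (Fc G (Fc G (\<iota> a)) \<star> \<psi>))
      = \<iota> (d (Fo G (Fo G A))) \<star> ((Fc G (\<iota> (d A)) \<star> \<psi>) \<bullet> (Fc G \<alpha> \<star> \<iota> v))"
    "\<iota> (d A) \<star> ((Fc G (\<iota> (e A)) \<star> \<psi>) \<bullet> (Fc G \<alpha>\<^sub>0 \<star> \<iota> v)) = \<iota> (d A) \<star> \<iota> v"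
    by (simp_all only: descent_laws)
  then have "(d A \<cdot> v, \<iota> (d (Fo G A)) \<star> \<psi>)
      \<in> descent_pairs K (map_coherence_data G (coalgebra_data A a \<alpha> \<alpha>\<^sub>0)) L"
    by (auto simp: coalgebra_data_def map_coherence_data_def descent_pairs_def hom_iff cells_iff
        whisker_left_def whisker_right_def pasting intro!: mor_eqI)
  from descent_factor[OF G_descent this] show ?thesis
    by (simp add: pasting)
qed

text \<open>The descent equations for \<open>(a, \<alpha>)\<close> are the coassociativity axiom and the first counit axiom
of the lax coalgebra.\<close>

lemma ex_left_adjoint:
  "\<exists>p. p \<in> Mor K \<and> dom K p = A \<and> cod K p = L \<and> \<iota> v \<star> \<iota> p = \<iota> a \<and> \<psi> \<star> \<iota> p = \<alpha>"
  using descent_factor[OF descent, of a \<alpha> A] descent_pair_iff[of a \<alpha>] lax_laws by auto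

end

text \<open>The structure map \<open>a'\<close> and the left adjoint \<open>p\<close> enter only through the equations that
characterize them as factorizations.\<close>

locale strictification = coalgebra_descent K G d e A a \<alpha> \<alpha>\<^sub>0 L v \<psi>
  for K :: "('o, 'm, 'c) two_cat" (structure)
    and G :: "('o, 'm, 'c, 'o, 'm, 'c) two_functor_maps"
    and d e :: "'o \<Rightarrow> 'm" and A a \<alpha> \<alpha>\<^sub>0 L v \<psi> +
  fixes a' p :: 'm
  assumes a'_simps [simp]: "a' \<in> Mor K" "dom K a' = L" "cod K a' = Fo G L"
    and v_a': "Fc G (\<iota> v) \<star> \<iota> a' = \<iota> (d A) \<star> \<iota> v"
    and \<psi>_a': "Fc G \<psi> \<star> \<iota> a' = \<iota> (d (Fo G A)) \<star> \<psi>"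
    and p_simps [simp]: "p \<in> Mor K" "dom K p = A" "cod K p = L"
    and v_p: "\<iota> v \<star> \<iota> p = \<iota> a"
    and \<psi>_p: "\<psi> \<star> \<iota> p = \<alpha>"
begin

lemmas factor_equations = v_a' \<psi>_a' v_p \<psi>_p
lemmas G_factor_equations = image_hcomp_exchange[OF v_a'] image_hcomp_exchange[OF \<psi>_a'] image_hcomp[OF v_p] image_hcomp[OF \<psi>_p]
lemmas GG_factor_equations = image_hcomp[OF G_factor_equations(3)] image_hcomp[OF G_factor_equations(4)]

lemmas factor_tails = hcomp_exchange_tail[OF v_a'] hcomp_exchange_tail[OF \<psi>_a']
  hcomp_tail[OF v_p] hcomp_tail[OF \<psi>_p]
lemmas G_factor_tails = hcomp_exchange_tail[OF G_factor_equations(1)] hcomp_exchange_tail[OF G_factor_equations(2)]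
  hcomp_tail[OF G_factor_equations(3)] hcomp_tail[OF G_factor_equations(4)]
  hcomp_tail[OF GG_factor_equations(1)] hcomp_tail[OF GG_factor_equations(2)]

lemmas descent_pasting = pasting factor_equations G_factor_equations
  GG_factor_equations factor_tails G_factor_tails

text \<open>Both sides agree after composition with \<open>G\<^sup>2v\<close> and \<open>G\<^sup>2\<psi>\<close>, by coassociativity and naturality
of \<open>d\<close>.\<close>

lemma strict_comult: "Fc G (\<iota> a') \<star> \<iota> a' = \<iota> (d L) \<star> \<iota> a'"
proof -
  have "Fm G a' \<cdot> a' = d L \<cdot> a'"
    by (rule descent_mor_eq[OF GG_descent]) (simp_all add: descent_pasting)
  from arg_cong[OF this, of "id_cell K"] show ?thesis by (simp add: descent_pasting)
qed

text \<open>By naturality of \<open>e\<close> and the law \<open>eGA \<cdot> dA = 1\<close>, the left side composed with \<open>v\<close> is \<open>v\<close>, and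
composed with \<open>\<psi>\<close> it is \<open>\<psi>\<close>.\<close>

lemma strict_counit: "\<iota> (e L) \<star> \<iota> a' = \<iota> (\<one> L)"
proof -
  have "e L \<cdot> a' = \<one> L"
    by (rule descent_mor_eq[OF descent]) (simp_all add: descent_pasting)
  from arg_cong[OF this, of "id_cell K"] show ?thesis by (simp add: descent_pasting)
qed

abbreviation "alg \<equiv> Coalg L a' (\<iota> (Fm G a' \<cdot> a')) (\<iota> (\<one> L))"
abbreviation "q \<equiv> e A \<cdot> v"
abbreviation "q\<^sub>2 \<equiv> \<iota> (e (Fo G A)) \<star> \<psi>"

lemma alg_in: "alg \<in> Obj EMC"
  by (rule strict_object_in_EM) (simp_all add: strict_comult strict_counit)

text \<open>The target is \<open>Gq \<cdot> a' = GeA \<cdot> Gv \<cdot> a' = GeA \<cdot> dA \<cdot> v = v\<close>, which is also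
\<open>eGA \<cdot> dA \<cdot> v\<close>.\<close>

lemma src_tgt_q\<^sub>2: "src K q\<^sub>2 = a \<cdot> q" "tgt K q\<^sub>2 = Fm G q \<cdot> a'"
  by (rule mor_eqI; simp add: descent_pasting)+

text \<open>Composing the descent equations with \<open>e\<close> yields exactly the two axioms of the lax morphism
\<open>(q, q\<^sub>2)\<close>.  The first equation also makes \<open>q\<^sub>2\<close> a morphism of descent pairs from \<open>p \<cdot> q\<close> to
the identity, and the second is a triangle identity.\<close>

lemma descent_laws_e:
  "\<iota> (e (Fo G (Fo G A))) \<star> ((\<iota> (d (Fo G A)) \<star> \<psi>) \<bullet> (Fc G (Fc G (\<iota> a)) \<star> \<psi>))
   = \<iota> (e (Fo G (Fo G A))) \<star> ((Fc G (\<iota> (d A)) \<star> \<psi>) \<bullet> (Fc G \<alpha> \<star> \<iota> v))"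
  "\<iota> (e A) \<star> ((Fc G (\<iota> (e A)) \<star> \<psi>) \<bullet> (Fc G \<alpha>\<^sub>0 \<star> \<iota> v)) = \<iota> (e A) \<star> \<iota> v"
  by (simp_all only: descent_laws)

lemma q_lax_morphism: "is_lax_morphism K G d e alg (Coalg A a \<alpha> \<alpha>\<^sub>0) q q\<^sub>2"
  using descent_laws_e src_tgt_q\<^sub>2 unfolding lax_morphism_iff by (simp add: descent_pasting)

lemma ex_adjunction_counit:
  "\<exists>\<epsilon>. \<epsilon> \<in> Cell K \<and> src K \<epsilon> = p \<cdot> q \<and> tgt K \<epsilon> = \<one> L \<and> \<iota> v \<star> \<epsilon> = q\<^sub>2"
  by (rule descent_cell_factor[OF descent])
     (use descent_laws_e in \<open>simp_all add: descent_pasting coalgebra_data_def\<close>)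

text \<open>The triangle identity at \<open>p\<close> may be tested after whiskering with \<open>v\<close>, where it is the second
counit axiom of the lax coalgebra.\<close>

lemma adjunction_p_q:
  assumes [simp]: "\<epsilon> \<in> Cell K" "src K \<epsilon> = p \<cdot> q" "tgt K \<epsilon> = \<one> L" and v_\<epsilon>: "\<iota> v \<star> \<epsilon> = q\<^sub>2"
  shows "adjunction_in K A L p q \<alpha>\<^sub>0 \<epsilon>"
proof -
  note [simp] = descent_pasting v_\<epsilon> hcomp_exchange_tail[OF v_\<epsilon>]
  have qp: "e A \<cdot> a = q \<cdot> p"
    by (rule mor_eqI) simp_all
  have "(\<epsilon> \<star> \<iota> p) \<bullet> (\<iota> p \<star> \<alpha>\<^sub>0) = \<iota> p"
    by (rule descent_cell_eq[OF descent]) (use lax_laws(3) in simp_all)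
  moreover have "(\<iota> q \<star> \<epsilon>) \<bullet> (\<alpha>\<^sub>0 \<star> \<iota> q) = \<iota> q"
    using descent_laws_e(2) by simp
  ultimately show ?thesis
    using qp by (simp add: adjunction_in_def hom_iff cells_iff whisker_left_def whisker_right_def del: descent_pasting)
qed

text \<open>Whiskered with \<open>Gv\<close>, the counit \<open>\<epsilon>\<close> inside the mate becomes \<open>Gq\<^sub>2\<close>, which composed with
\<open>a' \<cdot> p\<close> is \<open>\<psi> \<cdot> p = \<alpha>\<close>; the other two factors form the left side of the second counit
axiom whiskered with \<open>Ga\<close>, an identity.\<close>

lemma v_mate:
  assumes [simp]: "\<epsilon> \<in> Cell K" "src K \<epsilon> = p \<cdot> q" "tgt K \<epsilon> = \<one> L" and v_\<epsilon>: "\<iota> v \<star> \<epsilon> = q\<^sub>2"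
  defines "m \<equiv> mate K G a a' p \<alpha>\<^sub>0 \<epsilon> q\<^sub>2"
  shows "m \<in> Cell K" "src K m = Fm G p \<cdot> a" "tgt K m = a' \<cdot> p" "Fc G (\<iota> v) \<star> m = \<alpha>"
proof -
  note [simp] = descent_pasting v_\<epsilon> hcomp_exchange_tail[OF v_\<epsilon>] image_hcomp[OF v_\<epsilon>]
    hcomp_tail[OF image_hcomp[OF v_\<epsilon>]]
  note m = m_def mate_def whisker_left_def whisker_right_def
  show "m \<in> Cell K" "src K m = Fm G p \<cdot> a" "tgt K m = a' \<cdot> p"
    by (simp_all add: m)
  have "\<iota> (Fm G a) \<star> ((\<iota> (e (Fo G A)) \<star> \<alpha>) \<bullet> (\<iota> a \<star> \<alpha>\<^sub>0)) = \<iota> (Fm G a) \<star> \<iota> a"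
    by (simp only: lax_laws)
  then show "Fc G (\<iota> v) \<star> m = \<alpha>"
    by (simp add: m)
qed

text \<open>By \<open>v_mate\<close>, the two axioms reduce to the coassociativity axiom after whiskering with \<open>G\<^sup>2v\<close>,
and to the second counit axiom after whiskering with \<open>v\<close>.\<close>

lemma mate_colax_morphism:
  assumes \<epsilon>: "\<epsilon> \<in> Cell K" "src K \<epsilon> = p \<cdot> q" "tgt K \<epsilon> = \<one> L" "\<iota> v \<star> \<epsilon> = q\<^sub>2"
  shows "is_colax_morphism K G d e (Coalg A a \<alpha> \<alpha>\<^sub>0) alg p (mate K G a a' p \<alpha>\<^sub>0 \<epsilon> q\<^sub>2)"
proof -
  obtain m where m_def: "m = mate K G a a' p \<alpha>\<^sub>0 \<epsilon> q\<^sub>2" by simp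
  note m [simp] = v_mate(1-3)[OF \<epsilon>, folded m_def] and v_m = v_mate(4)[OF \<epsilon>, folded m_def]
  have G_v_m: "Fc G (Fc G (\<iota> v)) \<star> Fc G m = Fc G \<alpha>"
    by (rule image_hcomp[OF v_m]) simp_all
  have strict_comult_tail: "Fc G (\<iota> a') \<star> \<iota> a' \<star> w = \<iota> (d L) \<star> \<iota> a' \<star> w"
    if "w \<in> Cell K" "cod K (src K w) = L" for w
    using that strict_comult by (intro hcomp_exchange_tail) simp_all
  note [simp] = descent_pasting v_m hcomp_tail[OF v_m] G_v_m hcomp_tail[OF G_v_m]
    strict_comult strict_counit strict_comult_tail hcomp_tail[OF strict_counit]
  have "(\<iota> (Fm G a') \<star> m) \<bullet> (Fc G m \<star> \<iota> a) = (\<iota> (d L) \<star> m) \<bullet> (\<iota> (Fm G (Fm G p)) \<star> \<alpha>)"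
    by (rule descent_cell_eq[OF GG_descent]) (use lax_laws(1) in simp_all)
  moreover have "(\<iota> (e L) \<star> m) \<bullet> (\<iota> p \<star> \<alpha>\<^sub>0) = \<iota> p"
    by (rule descent_cell_eq[OF descent]) (use lax_laws(3) in simp_all)
  ultimately show ?thesis unfolding m_def[symmetric]
    by (simp add: hom_iff cells_iff whisker_left_def whisker_right_def)
qed

lemma q_in_hom [simp]: "q \<in> Mor K" "dom K q = L" "cod K q = A"
  by simp_all

text \<open>Since \<open>Gq \<cdot> a' = v\<close>, strictness of \<open>\<theta>\<close> gives \<open>v \<cdot> \<theta> = Gq \<cdot> a' \<cdot> \<theta> = Gq \<cdot> G\<theta> \<cdot> b\<close>, and likewise
for \<open>\<psi>\<close>.  Taking \<open>\<theta> = \<iota> g\<close> this shows that a strict morphism \<open>g\<close> is determined by its composite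
with \<open>(q, q\<^sub>2)\<close>.\<close>

lemma recover_from_q:
  assumes b [simp]: "b \<in> Mor K" "dom K b = B" "cod K b = Fo G B"
    and \<theta> [simp]: "\<theta> \<in> Cell K" "dom K (src K \<theta>) = B" "cod K (src K \<theta>) = L"
    and strict: "Fc G \<theta> \<star> \<iota> b = \<iota> a' \<star> \<theta>"
  shows "\<iota> v \<star> \<theta> = Fc G (\<iota> q \<star> \<theta>) \<star> \<iota> b"
    and "\<psi> \<star> \<theta> = Fc G (q\<^sub>2 \<star> \<theta>) \<star> \<iota> b"
  by (simp_all add: descent_pasting strict)

text \<open>The factorization \<open>g\<close> of \<open>(Gf \<cdot> b, Gf\<^sub>2 \<cdot> b)\<close> is a strict morphism because \<open>a' \<cdot> g\<close> and
\<open>Gg \<cdot> b\<close> agree after composition with \<open>Gv\<close> and \<open>G\<psi>\<close>: both become the image of the pair under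
\<open>G\<close>, precomposed with \<open>Gb \<cdot> b = dB \<cdot> b\<close>.\<close>

lemma ex_transpose:
  assumes Z: "Z \<in> Obj EMC" and f: "is_lax_morphism K G d e Z (Coalg A a \<alpha> \<alpha>\<^sub>0) f f\<^sub>2"
  shows "\<exists>g. g \<in> Mor K \<and> dom K g = carrier Z \<and> cod K g = L \<and>
    Fc G (\<iota> g) \<star> \<iota> (structure_mor Z) = \<iota> a' \<star> \<iota> g \<and> \<iota> q \<star> \<iota> g = \<iota> f \<and> q\<^sub>2 \<star> \<iota> g = f\<^sub>2"
proof -
  obtain b where b_def: "b = structure_mor Z" by simp
  note [simp] = EM_Obj_simps[OF Z, folded b_def] EM_Obj_tails[OF Z, folded b_def]
  have [simp]: "b \<in> Mor K" "dom K b = carrier Z" "cod K b = Fo G (carrier Z)" "carrier Z \<in> Obj K"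
    by (simp_all add: b_def)
  note f = f[unfolded lax_morphism_iff, folded b_def, simplified]
  have [simp]: "f \<in> Mor K" "dom K f = carrier Z" "cod K f = A" "f\<^sub>2 \<in> Cell K" "src K f\<^sub>2 = a \<cdot> f"
    "tgt K f\<^sub>2 = Fm G f \<cdot> b"
    using f by auto
  note [simp] = descent_pasting
  have G_comult: "Fc G (Fc G (\<iota> b)) \<star> Fc G (\<iota> b) = Fc G (\<iota> (d (carrier Z))) \<star> Fc G (\<iota> b)"
    by (rule image_hcomp_exchange) simp_all
  note [simp] = G_comult hcomp_exchange_tail[OF G_comult]
  \<comment> \<open>The two axioms on \<open>f\<^sub>2\<close>, under \<open>G\<close> and whiskered with \<open>b\<close>; the structure 2-cells of \<open>Z\<close> are identities and drop out.\<close>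
  have E1: "Fc G ((\<iota> (d A) \<star> f\<^sub>2) \<bullet> (\<alpha> \<star> \<iota> f)) \<star> \<iota> b = Fc G ((Fc G f\<^sub>2 \<star> \<iota> b) \<bullet> (\<iota> (Fm G a) \<star> f\<^sub>2)) \<star> \<iota> b"
    using f by simp
  have E2: "Fc G ((\<iota> (e A) \<star> f\<^sub>2) \<bullet> (\<alpha>\<^sub>0 \<star> \<iota> f)) \<star> \<iota> b = Fc G (\<iota> f) \<star> \<iota> b"
    using f by simp
  have src_tgt: "src K (Fc G f\<^sub>2 \<star> \<iota> b) = Fm G a \<cdot> Fm G f \<cdot> b" "tgt K (Fc G f\<^sub>2 \<star> \<iota> b) = d A \<cdot> Fm G f \<cdot> b"
    by (rule mor_eqI; simp)+
  have "(Fm G f \<cdot> b, Fc G f\<^sub>2 \<star> \<iota> b) \<in> descent_pairs K (coalgebra_data A a \<alpha> \<alpha>\<^sub>0) (carrier Z)"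
    using E1 E2 src_tgt descent_pair_iff[of "Fm G f \<cdot> b" "Fc G f\<^sub>2 \<star> \<iota> b"] by simp
  from descent_factor[OF descent this] obtain g where
    g [simp]: "g \<in> Mor K" "dom K g = carrier Z" "cod K g = L" and
    v_g [simp]: "\<iota> v \<star> \<iota> g = Fc G (\<iota> f) \<star> \<iota> b" and \<psi>_g [simp]: "\<psi> \<star> \<iota> g = Fc G f\<^sub>2 \<star> \<iota> b"
    by auto
  have G_g [simp]: "Fc G (\<iota> v) \<star> Fc G (\<iota> g) = Fc G (Fc G (\<iota> f) \<star> \<iota> b)" "Fc G \<psi> \<star> Fc G (\<iota> g) = Fc G (Fc G f\<^sub>2 \<star> \<iota> b)"
    using image_hcomp[OF v_g] image_hcomp[OF \<psi>_g] by simp_all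
  note [simp] = hcomp_tail[OF G_g(1)] hcomp_tail[OF G_g(2)]
  have "a' \<cdot> g = Fm G g \<cdot> b"
    by (rule descent_mor_eq[OF G_descent]) simp_all
  from arg_cong[OF this, of "id_cell K"]
  have "Fc G (\<iota> g) \<star> \<iota> b = \<iota> a' \<star> \<iota> g" by simp
  moreover have "\<iota> (e A) \<star> Fc G (\<iota> f) \<star> \<iota> b = \<iota> f" "\<iota> (e (Fo G A)) \<star> Fc G f\<^sub>2 \<star> \<iota> b = f\<^sub>2"
    using pasting_tails(2)[of "\<iota> f" "carrier Z" "\<iota> b"] pasting_tails(2)[of f\<^sub>2 "carrier Z" "\<iota> b"] by simp_all
  ultimately show ?thesis unfolding b_def[symmetric]
    by (intro exI[of _ g]) simp
qed

abbreviation "counit_q \<equiv> CoalgMor alg (Coalg A a \<alpha> \<alpha>\<^sub>0) q q\<^sub>2"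

lemma counit_q_in: "counit_q \<in> hom\<^bsub>LC\<^esub> alg (Coalg A a \<alpha> \<alpha>\<^sub>0)"
proof -
  have "counit_q \<in> Mor LC"
    using EM_Obj_simps(1)[OF alg_in] coalgebra_in q_lax_morphism
    by (subst LC_Mor) (simp only: coalg_mor.sel simp_thms)
  then show ?thesis by (simp add: hom_def)
qed

lemma EM_hom_alg:
  assumes "F \<in> hom\<^bsub>EMC\<^esub> Z alg"
  shows "F \<in> Mor LC" "F = CoalgMor Z alg (mor_under F) (\<iota> (a' \<cdot> mor_under F))" "mor_under F \<in> Mor K"
    "dom K (mor_under F) = carrier Z" "cod K (mor_under F) = L"
    "Fc G (\<iota> (mor_under F)) \<star> \<iota> (structure_mor Z) = \<iota> a' \<star> \<iota> (mor_under F)"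
proof -
  have F: "F \<in> Mor EMC" "mor_dom F = Z" "mor_cod F = alg"
    using assms by (auto simp: hom_def)
  then show "F \<in> Mor LC" by (simp add: EM_Mor)
  then show "F = CoalgMor Z alg (mor_under F) (\<iota> (a' \<cdot> mor_under F))" "mor_under F \<in> Mor K"
    "dom K (mor_under F) = carrier Z" "cod K (mor_under F) = L"
    "Fc G (\<iota> (mor_under F)) \<star> \<iota> (structure_mor Z) = \<iota> a' \<star> \<iota> (mor_under F)"
    using F EM_Mor_strict[OF F(1)] by (auto simp: EM_Mor intro: coalg_mor.expand)
qed

text \<open>The structure cell of a strict morphism is an identity and disappears from the composite.\<close>

lemma counit_comp:
  assumes "F \<in> hom\<^bsub>EMC\<^esub> Z alg"
  shows "coalg_mor_comp K G counit_q F = CoalgMor Z (Coalg A a \<alpha> \<alpha>\<^sub>0) (q \<cdot> mor_under F) (q\<^sub>2 \<star> \<iota> (mor_under F))"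
proof -
  note F = EM_hom_alg[OF assms]
  have "mor_dom F = Z" "mor_cell F = \<iota> (a' \<cdot> mor_under F)"
    by (metis F(2) coalg_mor.sel)+
  then show ?thesis
    using F(3-5) by (intro coalg_mor.expand) (auto simp: descent_pasting)
qed

lemma counit_universal_mor:
  assumes Z: "Z \<in> Obj EMC"
  shows "bij_betw (\<lambda>F. coalg_mor_comp K G counit_q F) (hom\<^bsub>EMC\<^esub> Z alg) (hom\<^bsub>LC\<^esub> Z (Coalg A a \<alpha> \<alpha>\<^sub>0))"
proof (rule bij_betw_imageI)
  note [simp] = EM_Obj_simps(1)[OF Z]
  show "inj_on (\<lambda>F. coalg_mor_comp K G counit_q F) (hom\<^bsub>EMC\<^esub> Z alg)"
  proof (rule inj_onI)
    fix F F' assume F: "F \<in> hom\<^bsub>EMC\<^esub> Z alg" and F': "F' \<in> hom\<^bsub>EMC\<^esub> Z alg"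
      and eq: "coalg_mor_comp K G counit_q F = coalg_mor_comp K G counit_q F'"
    note F_simps [simp] = EM_hom_alg(3-5)[OF F] EM_hom_alg(3-5)[OF F']
    have eqs: "q \<cdot> mor_under F = q \<cdot> mor_under F'" "q\<^sub>2 \<star> \<iota> (mor_under F) = q\<^sub>2 \<star> \<iota> (mor_under F')"
      using eq unfolding counit_comp[OF F] counit_comp[OF F'] by auto
    have q_eq: "\<iota> q \<star> \<iota> (mor_under F) = \<iota> q \<star> \<iota> (mor_under F')"
      using arg_cong[OF eqs(1), of "id_cell K"] by (simp only: id_cell_comp F_simps q_in_hom)
    have "mor_under F = mor_under F'"
    proof (rule descent_mor_eq[OF descent])
      note recover = recover_from_q[OF _ _ _ _ _ _ EM_hom_alg(6)[OF F], of "carrier Z"]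
        recover_from_q[OF _ _ _ _ _ _ EM_hom_alg(6)[OF F'], of "carrier Z"]
      have "\<iota> v \<star> \<iota> (mor_under F) = Fc G (\<iota> q \<star> \<iota> (mor_under F)) \<star> \<iota> (structure_mor Z)"
        by (rule recover(1)) simp_all
      also have "\<dots> = \<iota> v \<star> \<iota> (mor_under F')"
        unfolding q_eq by (rule recover(3)[symmetric]) simp_all
      finally show "\<iota> v \<star> \<iota> (mor_under F) = \<iota> v \<star> \<iota> (mor_under F')" .
      have "\<psi> \<star> \<iota> (mor_under F) = Fc G (q\<^sub>2 \<star> \<iota> (mor_under F)) \<star> \<iota> (structure_mor Z)"
        by (rule recover(2)) simp_all
      also have "\<dots> = \<psi> \<star> \<iota> (mor_under F')"
        unfolding eqs(2) by (rule recover(4)[symmetric]) simp_all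
      finally show "\<psi> \<star> \<iota> (mor_under F) = \<psi> \<star> \<iota> (mor_under F')" .
    qed simp_all
    then show "F = F'"
      using EM_hom_alg(2)[OF F] EM_hom_alg(2)[OF F'] by simp
  qed
  show "(\<lambda>F. coalg_mor_comp K G counit_q F) ` (hom\<^bsub>EMC\<^esub> Z alg) = hom\<^bsub>LC\<^esub> Z (Coalg A a \<alpha> \<alpha>\<^sub>0)"
  proof (intro equalityI subsetI)
    fix H assume "H \<in> (\<lambda>F. coalg_mor_comp K G counit_q F) ` (hom\<^bsub>EMC\<^esub> Z alg)"
    then show "H \<in> hom\<^bsub>LC\<^esub> Z (Coalg A a \<alpha> \<alpha>\<^sub>0)"
      using counit_q_in by (auto simp: hom_def EM_Mor)
  next
    fix H assume H: "H \<in> hom\<^bsub>LC\<^esub> Z (Coalg A a \<alpha> \<alpha>\<^sub>0)"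
    then have H': "mor_dom H = Z" "mor_cod H = Coalg A a \<alpha> \<alpha>\<^sub>0" "H \<in> Mor LC"
      by (auto simp: hom_def)
    then have lax: "is_lax_morphism K G d e Z (Coalg A a \<alpha> \<alpha>\<^sub>0) (mor_under H) (mor_cell H)"
      by (metis LC_Mor)
    from ex_transpose[OF Z lax] obtain g where
      g: "g \<in> Mor K" "dom K g = carrier Z" "cod K g = L"
      "Fc G (\<iota> g) \<star> \<iota> (structure_mor Z) = \<iota> a' \<star> \<iota> g" and
      q_g: "\<iota> q \<star> \<iota> g = \<iota> (mor_under H)" "q\<^sub>2 \<star> \<iota> g = mor_cell H" by blast
    have "CoalgMor Z alg g (\<iota> (structure_mor alg \<cdot> g)) \<in> Mor EMC"
      using g by (intro strict_morphism_in_EM[OF Z alg_in]) simp_all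
    then have F: "CoalgMor Z alg g (\<iota> (a' \<cdot> g)) \<in> hom\<^bsub>EMC\<^esub> Z alg"
      by (simp add: hom_def)
    have "q \<cdot> g = mor_under H"
      using q_g(1) g H' by (intro mor_eqI) (simp_all add: id_cell_comp)
    then have "coalg_mor_comp K G counit_q (CoalgMor Z alg g (\<iota> (a' \<cdot> g))) = H"
      unfolding counit_comp[OF F] using q_g(2) H' by (intro coalg_mor.expand) auto
    with F show "H \<in> (\<lambda>F. coalg_mor_comp K G counit_q F) ` (hom\<^bsub>EMC\<^esub> Z alg)"
      by blast
  qed
qed

text \<open>A transformation \<open>\<rho>\<close> between the composites lifts to the 2-cell \<open>\<theta>\<close> with \<open>v \<cdot> \<theta> = G\<rho> \<cdot> b\<close>.
That \<open>G\<rho> \<cdot> b\<close> is a morphism of descent pairs is the image under \<open>G\<close> of the law for \<open>\<rho>\<close>.\<close>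

lemma counit_universal_cell:
  assumes Z: "Z \<in> Obj EMC" and F: "F \<in> hom\<^bsub>EMC\<^esub> Z alg" and F': "F' \<in> hom\<^bsub>EMC\<^esub> Z alg"
  shows "bij_betw (\<lambda>\<sigma>. hcomp LC (id_cell LC counit_q) \<sigma>) (cells\<^bsub>EMC\<^esub> F F')
    (cells\<^bsub>LC\<^esub> (coalg_mor_comp K G counit_q F) (coalg_mor_comp K G counit_q F'))"
proof -
  define b where "b = structure_mor Z"
  define f where "f = mor_under F"
  define f' where "f' = mor_under F'"
  note [simp] = EM_Obj_simps[OF Z, folded b_def] EM_Obj_tails[OF Z, folded b_def]
  have Zs [simp]: "b \<in> Mor K" "dom K b = carrier Z" "cod K b = Fo G (carrier Z)" "carrier Z \<in> Obj K"
    by (simp_all add: b_def)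
  have F_in: "F \<in> Mor EMC" "F' \<in> Mor EMC" and dc: "mor_dom F = Z" "mor_dom F' = Z" "mor_cod F = alg" "mor_cod F' = alg"
    using F F' by (auto simp: hom_def)
  note Fs [simp] = EM_hom_alg(3-5)[OF F, folded f_def] EM_hom_alg(3-5)[OF F', folded f'_def]
  note f_strict = EM_hom_alg(6)[OF F, folded f_def b_def] EM_hom_alg(6)[OF F', folded f'_def b_def]
  have EM_cells: "CoalgCell F F' \<theta> \<in> cells\<^bsub>EMC\<^esub> F F' \<longleftrightarrow> \<theta> \<in> Cell K \<and> src K \<theta> = f \<and> tgt K \<theta> = f' \<and>
     Fc G \<theta> \<star> \<iota> b = \<iota> a' \<star> \<theta>" for \<theta>
    using F_in dc by (auto simp: cells_def EM_Cell_iff f_def f'_def b_def)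
  let ?H = "coalg_mor_comp K G counit_q F" and ?H' = "coalg_mor_comp K G counit_q F'"
  have H_in: "?H \<in> Mor LC" "?H' \<in> Mor LC"
    using counit_universal_mor[OF Z] F F' unfolding bij_betw_def hom_def by auto
  have LC_cells: "CoalgCell ?H ?H' \<rho> \<in> cells\<^bsub>LC\<^esub> ?H ?H' \<longleftrightarrow> \<rho> \<in> Cell K \<and> src K \<rho> = q \<cdot> f \<and> tgt K \<rho> = q \<cdot> f' \<and>
     (Fc G \<rho> \<star> \<iota> b) \<bullet> (q\<^sub>2 \<star> \<iota> f) = (q\<^sub>2 \<star> \<iota> f') \<bullet> (\<iota> a \<star> \<rho>)" for \<rho>
    using H_in unfolding cells_def counit_comp[OF F] counit_comp[OF F']
    by (auto simp: LC_CoalgCell G_transformation_iff f_def f'_def b_def)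
  have whisker: "hcomp LC (id_cell LC counit_q) \<sigma> = CoalgCell ?H ?H' (\<iota> q \<star> cell_under \<sigma>)" if "\<sigma> \<in> cells\<^bsub>EMC\<^esub> F F'" for \<sigma>
    using that by (simp add: cells_def)
  have EM_form: "\<sigma> = CoalgCell F F' (cell_under \<sigma>)" if "\<sigma> \<in> cells\<^bsub>EMC\<^esub> F F'" for \<sigma>
    using that by (auto simp: cells_def intro: coalg_cell.expand)
  have LC_form: "\<sigma> = CoalgCell ?H ?H' (cell_under \<sigma>)" if "\<sigma> \<in> cells\<^bsub>LC\<^esub> ?H ?H'" for \<sigma>
    using that by (auto simp: cells_def intro: coalg_cell.expand)
  have EM_under: "cell_under \<sigma> \<in> Cell K \<and> src K (cell_under \<sigma>) = f \<and> tgt K (cell_under \<sigma>) = f' \<and>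
     Fc G (cell_under \<sigma>) \<star> \<iota> b = \<iota> a' \<star> cell_under \<sigma>" if "\<sigma> \<in> cells\<^bsub>EMC\<^esub> F F'" for \<sigma>
    using that EM_form[OF that] EM_cells by metis
  have LC_under: "cell_under \<sigma> \<in> Cell K \<and> src K (cell_under \<sigma>) = q \<cdot> f \<and> tgt K (cell_under \<sigma>) = q \<cdot> f' \<and>
     (Fc G (cell_under \<sigma>) \<star> \<iota> b) \<bullet> (q\<^sub>2 \<star> \<iota> f) = (q\<^sub>2 \<star> \<iota> f') \<bullet> (\<iota> a \<star> cell_under \<sigma>)"
    if "\<sigma> \<in> cells\<^bsub>LC\<^esub> ?H ?H'" for \<sigma>
    using that LC_form[OF that] LC_cells by metis
  show ?thesis
  proof (rule bij_betw_imageI)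
    show "inj_on (\<lambda>\<sigma>. hcomp LC (id_cell LC counit_q) \<sigma>) (cells\<^bsub>EMC\<^esub> F F')"
    proof (rule inj_onI)
      fix \<sigma> \<sigma>' assume \<sigma>: "\<sigma> \<in> cells\<^bsub>EMC\<^esub> F F'" and \<sigma>': "\<sigma>' \<in> cells\<^bsub>EMC\<^esub> F F'"
        and eq: "hcomp LC (id_cell LC counit_q) \<sigma> = hcomp LC (id_cell LC counit_q) \<sigma>'"
      have under_eq: "\<iota> q \<star> cell_under \<sigma> = \<iota> q \<star> cell_under \<sigma>'"
        using eq unfolding whisker[OF \<sigma>] whisker[OF \<sigma>'] by simp
      note s = EM_under[OF \<sigma>] EM_under[OF \<sigma>']
      have "\<iota> v \<star> cell_under \<sigma> = Fc G (\<iota> q \<star> cell_under \<sigma>) \<star> \<iota> b"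
        using s by (intro recover_from_q(1)[where B = "carrier Z"]) simp_all
      also have "\<dots> = \<iota> v \<star> cell_under \<sigma>'"
        unfolding under_eq using s by (intro recover_from_q(1)[where B = "carrier Z", symmetric]) simp_all
      finally have "\<iota> v \<star> cell_under \<sigma> = \<iota> v \<star> cell_under \<sigma>'" .
      then have "cell_under \<sigma> = cell_under \<sigma>'"
        by (rule descent_cell_eq[OF descent]) (simp_all add: s)
      then show "\<sigma> = \<sigma>'" using EM_form[OF \<sigma>] EM_form[OF \<sigma>'] by metis
    qed
    show "(\<lambda>\<sigma>. hcomp LC (id_cell LC counit_q) \<sigma>) ` cells\<^bsub>EMC\<^esub> F F' = cells\<^bsub>LC\<^esub> ?H ?H'"
    proof (intro equalityI subsetI)
      fix \<tau> assume "\<tau> \<in> (\<lambda>\<sigma>. hcomp LC (id_cell LC counit_q) \<sigma>) ` cells\<^bsub>EMC\<^esub> F F'"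
      then obtain \<sigma> where \<sigma>: "\<sigma> \<in> cells\<^bsub>EMC\<^esub> F F'" and \<tau>: "\<tau> = hcomp LC (id_cell LC counit_q) \<sigma>" by blast
      interpret LC: two_category LC by (rule two_category_LC)
      have "\<sigma> \<in> cells\<^bsub>LC\<^esub> F F'" "F \<in> hom\<^bsub>LC\<^esub> Z alg" "id_cell LC counit_q \<in> cells\<^bsub>LC\<^esub> counit_q counit_q"
        using \<sigma> F F' counit_q_in LC.id_cell_in[of counit_q] by (auto simp: cells_def hom_def EM_Cell EM_Mor)
      from LC.hcomp_in[OF this(2,1) counit_q_in this(3)] show "\<tau> \<in> cells\<^bsub>LC\<^esub> ?H ?H'"
        by (simp add: \<tau>)
    next
      fix \<tau> assume \<tau>: "\<tau> \<in> cells\<^bsub>LC\<^esub> ?H ?H'"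
      obtain \<rho> where \<rho>_def: "\<rho> = cell_under \<tau>" by simp
      have \<rho> [simp]: "\<rho> \<in> Cell K" "src K \<rho> = q \<cdot> f" "tgt K \<rho> = q \<cdot> f'"
        and \<rho>_law: "(Fc G \<rho> \<star> \<iota> b) \<bullet> (q\<^sub>2 \<star> \<iota> f) = (q\<^sub>2 \<star> \<iota> f') \<bullet> (\<iota> a \<star> \<rho>)"
        using LC_under[OF \<tau>] by (simp_all add: \<rho>_def)
      have G_f_strict: "Fc G (Fc G (\<iota> f)) \<star> Fc G (\<iota> b) = Fc G (\<iota> a') \<star> Fc G (\<iota> f)"
        by (rule image_hcomp_exchange[OF f_strict(1)]) simp_all
      note [simp] = descent_pasting f_strict G_f_strict
      have "Fc G ((Fc G \<rho> \<star> \<iota> b) \<bullet> (q\<^sub>2 \<star> \<iota> f)) \<star> \<iota> b = Fc G ((q\<^sub>2 \<star> \<iota> f') \<bullet> (\<iota> a \<star> \<rho>)) \<star> \<iota> b"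
        by (simp only: \<rho>_law)
      then have "\<exists>\<theta>. \<theta> \<in> Cell K \<and> src K \<theta> = f \<and> tgt K \<theta> = f' \<and> \<iota> v \<star> \<theta> = Fc G \<rho> \<star> \<iota> b"
        by (intro descent_cell_factor[OF descent]) (simp_all add: coalgebra_data_def)
      then obtain \<theta> where \<theta> [simp]: "\<theta> \<in> Cell K" "src K \<theta> = f" "tgt K \<theta> = f'"
        and v_\<theta> [simp]: "\<iota> v \<star> \<theta> = Fc G \<rho> \<star> \<iota> b"
        by blast
      have G_v_\<theta> [simp]: "Fc G (\<iota> v) \<star> Fc G \<theta> = Fc G (Fc G \<rho> \<star> \<iota> b)"
        by (rule image_hcomp) simp_all
      \<comment> \<open>Strictness of \<open>\<theta>\<close> is tested after whiskering with \<open>Gv\<close>.\<close>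
      have "Fc G \<theta> \<star> \<iota> b = \<iota> a' \<star> \<theta>"
        by (rule descent_cell_eq[OF G_descent]) (simp_all add: hcomp_tail[OF G_v_\<theta>])
      then have "CoalgCell F F' \<theta> \<in> cells\<^bsub>EMC\<^esub> F F'"
        using \<theta> by (subst EM_cells) simp
      moreover have "\<iota> q \<star> \<theta> = \<rho>"
        using pasting_tails(2)[of \<rho> "carrier Z" "\<iota> b"] by simp
      ultimately show "\<tau> \<in> (\<lambda>\<sigma>. hcomp LC (id_cell LC counit_q) \<sigma>) ` cells\<^bsub>EMC\<^esub> F F'"
        using whisker[of "CoalgCell F F' \<theta>"] LC_form[OF \<tau>, folded \<rho>_def] by (metis coalg_cell.sel(3) image_eqI)
    qed
  qed
qed

end

section \<open>The coreflection\<close>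

context two_comonad
begin

lemma coalgebra_data_lax:
  assumes "is_lax_coalgebra K G d e (Coalg A a \<alpha> \<alpha>\<^sub>0)"
  shows "lax_coherence_data K (coalgebra_data A a \<alpha> \<alpha>\<^sub>0)"
proof -
  note X = assms[folded LC_Obj]
  note [simp] = LC_Obj_simps[OF X, simplified] pasting
  \<comment> \<open>The sources and targets required of \<open>delta\<close>, \<open>kappa\<close> and \<open>rho\<close>.\<close>
  have "Fm G (e A) \<cdot> d A = \<one> (Fo G A)" "Fm G (d A) \<cdot> d A = d (Fo G A) \<cdot> d A"
    "d (Fo G A) \<cdot> Fm G a = Fm G (Fm G a) \<cdot> d A"
    by (rule mor_eqI; simp)+
  then show ?thesis
    by (simp add: lax_coherence_data_def coalgebra_data_def hom_iff cells_iff del: id_cell_comp)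
qed

text \<open>Says that \<open>c\<close> is a universal arrow from the inclusion of strict coalgebras to \<open>X\<close>, in the
2-categorical sense.\<close>

definition coreflection :: "('o, 'm, 'c) coalg \<Rightarrow> ('o, 'm, 'c) coalg \<Rightarrow> ('o, 'm, 'c) coalg_mor \<Rightarrow> bool"
  where "coreflection X Y c \<longleftrightarrow> Y \<in> Obj EMC \<and> c \<in> hom\<^bsub>LC\<^esub> Y X \<and>
    (\<forall>Z \<in> Obj EMC. bij_betw (\<lambda>F. coalg_mor_comp K G c F) (hom\<^bsub>EMC\<^esub> Z Y) (hom\<^bsub>LC\<^esub> Z X)) \<and>
    (\<forall>Z \<in> Obj EMC. \<forall>F \<in> hom\<^bsub>EMC\<^esub> Z Y. \<forall>F' \<in> hom\<^bsub>EMC\<^esub> Z Y.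
      bij_betw (\<lambda>\<sigma>. hcomp LC (id_cell LC c) \<sigma>) (cells\<^bsub>EMC\<^esub> F F')
        (cells\<^bsub>LC\<^esub> (coalg_mor_comp K G c F) (coalg_mor_comp K G c F')))"

definition counit_with_left_adjoint :: "('o, 'm, 'c) coalg \<Rightarrow> ('o, 'm, 'c) coalg \<Rightarrow> ('o, 'm, 'c) coalg_mor \<Rightarrow> bool"
  where "counit_with_left_adjoint X Y c \<longleftrightarrow> (\<exists>L a' q q\<^sub>2 p \<eta> \<epsilon>.
      Y = Coalg L a' (\<iota> (Fm G a' \<cdot> a')) (\<iota> (\<one> L)) \<and> c = CoalgMor Y X q q\<^sub>2 \<and>
      is_lax_morphism K G d e Y X q q\<^sub>2 \<and> adjunction_in K (carrier X) L p q \<eta> \<epsilon> \<and>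
      is_colax_morphism K G d e X Y p (mate K G (structure_mor X) a' p \<eta> \<epsilon> q\<^sub>2))"

lemma ex_coreflection:
  assumes has: "has_lax_descent_objects K" and preserves: "preserves_lax_descent_objects K K G"
    and X: "X \<in> Obj LC"
  shows "\<exists>Y c. coreflection X Y c \<and> counit_with_left_adjoint X Y c"
proof -
  obtain A a \<alpha> \<alpha>\<^sub>0 where X_def: "X = Coalg A a \<alpha> \<alpha>\<^sub>0" by (cases X)
  have lax: "is_lax_coalgebra K G d e (Coalg A a \<alpha> \<alpha>\<^sub>0)"
    using X by (simp add: LC_Obj X_def)
  let ?D = "coalgebra_data A a \<alpha> \<alpha>\<^sub>0"
  have D: "lax_coherence_data K ?D" by (rule coalgebra_data_lax[OF lax])
  then have GD: "lax_coherence_data K (map_coherence_data G ?D)"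
    by (rule comult.F.map_coherence_data_lax)
  obtain L v \<psi> where descent: "lax_descent_object K ?D L v \<psi>"
    using has D unfolding has_lax_descent_objects_def by blast
  have G_descent: "lax_descent_object K (map_coherence_data G ?D) (Fo G L) (Fm G v) (Fc G \<psi>)"
    using preserves D descent unfolding preserves_lax_descent_objects_def by blast
  then have GG_descent: "lax_descent_object K (map_coherence_data G (map_coherence_data G ?D))
      (Fo G (Fo G L)) (Fm G (Fm G v)) (Fc G (Fc G \<psi>))"
    using preserves GD unfolding preserves_lax_descent_objects_def by blast
  interpret coalgebra_descent K G d e A a \<alpha> \<alpha>\<^sub>0 L v \<psi>
    using lax descent G_descent GG_descent by unfold_locales
  obtain a' p where "strictification K G d e A a \<alpha> \<alpha>\<^sub>0 L v \<psi> a' p"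
    using ex_strict_structure ex_left_adjoint
    by (auto simp: strictification_def strictification_axioms_def coalgebra_descent_axioms)
  then interpret strictification K G d e A a \<alpha> \<alpha>\<^sub>0 L v \<psi> a' p .
  obtain \<epsilon> where \<epsilon>: "\<epsilon> \<in> Cell K" "src K \<epsilon> = p \<cdot> q" "tgt K \<epsilon> = \<one> L" "\<iota> v \<star> \<epsilon> = q\<^sub>2"
    using ex_adjunction_counit by blast
  have "coreflection X alg counit_q"
    using alg_in counit_q_in counit_universal_mor counit_universal_cell
    unfolding coreflection_def X_def by blast
  moreover have "counit_with_left_adjoint X alg counit_q"
    using q_lax_morphism adjunction_p_q[OF \<epsilon>] mate_colax_morphism[OF \<epsilon>]
    unfolding counit_with_left_adjoint_def X_def coalg.sel by blast
  ultimately show ?thesis by blast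
qed

end

theorem theorem8p6:
  fixes K :: "('o, 'm, 'c) two_cat"
    and G :: "('o, 'm, 'c, 'o, 'm, 'c) two_functor_maps"
    and d e :: "'o \<Rightarrow> 'm"
  assumes "two_comonad K G d e"
    and "has_lax_descent_objects K"
    and "preserves_lax_descent_objects K K G"
  shows "\<exists>R u c.
    two_adjunction (EM K G d e) (Lax_Coalg K G d e) Fid R u c \<and>
    (\<forall>A a \<alpha> \<alpha>\<^sub>0. is_lax_coalgebra K G d e (Coalg A a \<alpha> \<alpha>\<^sub>0) \<longrightarrow>
      (\<exists>algA a' q q\<^sub>2 p \<eta> \<epsilon>.
        Fo R (Coalg A a \<alpha> \<alpha>\<^sub>0)
          = Coalg algA a' (\<iota>\<^bsub>K\<^esub> (Fm G a' \<cdot>\<^bsub>K\<^esub> a')) (\<iota>\<^bsub>K\<^esub> (\<one>\<^bsub>K\<^esub> algA)) \<and>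
        c (Coalg A a \<alpha> \<alpha>\<^sub>0)
          = CoalgMor (Fo R (Coalg A a \<alpha> \<alpha>\<^sub>0)) (Coalg A a \<alpha> \<alpha>\<^sub>0) q q\<^sub>2 \<and>
        is_lax_morphism K G d e (Fo R (Coalg A a \<alpha> \<alpha>\<^sub>0)) (Coalg A a \<alpha> \<alpha>\<^sub>0) q q\<^sub>2 \<and>
        adjunction_in K A algA p q \<eta> \<epsilon> \<and>
        is_colax_morphism K G d e (Coalg A a \<alpha> \<alpha>\<^sub>0) (Fo R (Coalg A a \<alpha> \<alpha>\<^sub>0))
          p (mate K G a a' p \<eta> \<epsilon> q\<^sub>2)))"
proof -
  interpret two_comonad K G d e by fact
  obtain R\<^sub>0 c where coreflection: "\<And>X. X \<in> Obj LC \<Longrightarrow> coreflection X (R\<^sub>0 X) (c X)"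
    and counit: "\<And>X. X \<in> Obj LC \<Longrightarrow> counit_with_left_adjoint X (R\<^sub>0 X) (c X)"
    using ex_coreflection[OF assms(2,3)] by metis
  have "\<exists>R u. two_adjunction EMC LC Fid R u c \<and> Fo R = R\<^sub>0"
  proof (rule two_adjunction_of_universal_arrows[OF two_functor_EM_LC])
    fix X Z assume X: "X \<in> Obj LC"
    then show "R\<^sub>0 X \<in> Obj EMC" "c X \<in> hom\<^bsub>LC\<^esub> (Fo Fid (R\<^sub>0 X)) X"
      using coreflection by (simp_all add: coreflection_def)
    assume Z: "Z \<in> Obj EMC"
    show "bij_betw (\<lambda>g. c X \<cdot>\<^bsub>LC\<^esub> Fm Fid g) (hom\<^bsub>EMC\<^esub> Z (R\<^sub>0 X)) (hom\<^bsub>LC\<^esub> (Fo Fid Z) X)"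
      using coreflection[OF X] Z by (simp add: coreflection_def)
    fix g g' assume "g \<in> hom\<^bsub>EMC\<^esub> Z (R\<^sub>0 X)" "g' \<in> hom\<^bsub>EMC\<^esub> Z (R\<^sub>0 X)"
    then show "bij_betw (\<lambda>\<theta>. c X \<rhd>\<^bsub>LC\<^esub> Fc Fid \<theta>) (cells\<^bsub>EMC\<^esub> g g')
        (cells\<^bsub>LC\<^esub> (c X \<cdot>\<^bsub>LC\<^esub> Fm Fid g) (c X \<cdot>\<^bsub>LC\<^esub> Fm Fid g'))"
      using coreflection[OF X] Z by (auto simp: coreflection_def whisker_left_def)
  qed
  then obtain R u where adj: "two_adjunction EMC LC Fid R u c" and R: "Fo R = R\<^sub>0"
    by blast
  show ?thesis
  proof (rule exI[of _ R], rule exI[of _ u], rule exI[of _ c], intro conjI allI impI)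
    show "two_adjunction EMC LC Fid R u c" by (rule adj)
    fix A a \<alpha> \<alpha>\<^sub>0 assume "is_lax_coalgebra K G d e (Coalg A a \<alpha> \<alpha>\<^sub>0)"
    then have "Coalg A a \<alpha> \<alpha>\<^sub>0 \<in> Obj LC" by (simp add: LC_Obj)
    from counit[OF this] show "\<exists>algA a' q q\<^sub>2 p \<eta> \<epsilon>.
        Fo R (Coalg A a \<alpha> \<alpha>\<^sub>0) = Coalg algA a' (\<iota>\<^bsub>K\<^esub> (Fm G a' \<cdot>\<^bsub>K\<^esub> a')) (\<iota>\<^bsub>K\<^esub> (\<one>\<^bsub>K\<^esub> algA)) \<and>
        c (Coalg A a \<alpha> \<alpha>\<^sub>0) = CoalgMor (Fo R (Coalg A a \<alpha> \<alpha>\<^sub>0)) (Coalg A a \<alpha> \<alpha>\<^sub>0) q q\<^sub>2 \<and>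
        is_lax_morphism K G d e (Fo R (Coalg A a \<alpha> \<alpha>\<^sub>0)) (Coalg A a \<alpha> \<alpha>\<^sub>0) q q\<^sub>2 \<and>
        adjunction_in K A algA p q \<eta> \<epsilon> \<and>
        is_colax_morphism K G d e (Coalg A a \<alpha> \<alpha>\<^sub>0) (Fo R (Coalg A a \<alpha> \<alpha>\<^sub>0))
          p (mate K G a a' p \<eta> \<epsilon> q\<^sub>2)"
      unfolding R counit_with_left_adjoint_def coalg.sel .
  qed
qed

end
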